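(* Let $T$ be maximal monotone and let a stochastic first-order oracle for $T$ with state-dependent moment bounds be available (as described in the context). Let $\lambda>0$ and $N_k=\lceil (k+1)^{2a}\rceil$ for all $k$, where $a>1$. Let $\{\mathbf{x}^k\}$ be a sequence generated by the variance-reduced stochastic proximal-point scheme (VR-SPP) described in the context. Then for any starting point $\mathbf{x}^0$, almost surely $\mathbf{x}^k\to\mathbf{x}^*$ as $k\to\infty$ for some (random) $\mathbf{x}^*\in X^*$, where $X^*=T^{-1}(0)$ is the solution set of $0\in T(\mathbf{x})$.
   Context: Game. There are $\mathbf{N}$ players; player $i$ has a closed convex strategy set $\mathcal{X}_i\subseteq\mathbb{R}^{n_i}$, $\sum_i n_i=n$, $\mathcal{X}=\prod_i\mathcal{X}_i$. Given $\mathbf{x}^{-i}=(\mathbf{x}^j)_{j\ne i}$, player $i$ minimizes over $\mathbf{x}^i\in\mathcal{X}_i$ the function $\mathbb{E}[\tilde f_i(\mathbf{x}^i,\mathbf{x}^{-i},\mathbf{y}^i(\mathbf{x},\omega),\omega)]$, where $\mathbf{y}^i(\mathbf{x},\omega)$ is the unique solution of the lower-level variational inequality $\mathrm{VI}(\mathcal{Y}_i,F_i(\cdot,\mathbf{x},\omega))$ with $\mathcal{Y}_i$ closed convex and $F_i(\cdot,\mathbf{x},\omega)$ strongly monotone for every $\mathbf{x}\in\mathcal{X}$ and $\omega$; for each $\omega$ and each $\mathbf{x}^{-i}$, the implicit function $\mathbf{x}^i\mapsto\tilde f_i(\mathbf{x}^i,\mathbf{x}^{-i},\mathbf{y}^i(\mathbf{x},\omega),\omega)$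 is convex on $\mathcal{X}_i$. Set $\Phi(\mathbf{x},\mathbf{y}(\mathbf{x},\omega),\omega)=\prod_{i=1}^{\mathbf{N}}[\partial_{\mathbf{x}^i}\tilde f_i(\mathbf{x}^i,\mathbf{x}^{-i},\mathbf{y}^i(\mathbf{x},\omega),\omega)+\mathcal{N}_{\mathcal{X}_i}(\mathbf{x}^i)]$ (normal cone $\mathcal{N}$; subdifferential of the implicit function in $\mathbf{x}^i$) and $T(\mathbf{x})=\mathbb{E}[\Phi(\mathbf{x},\mathbf{y}(\mathbf{x},\omega),\omega)]$ (Aumann expectation). $T:\mathbb{R}^n\rightrightarrows\mathbb{R}^n$ is assumed monotone, and the game is assumed to have a Nash equilibrium, so $T^{-1}(0)\neq\emptyset$. Oracle. There are constants $M_1,M_2$ such that, given any $\mathbf{x}$, the oracle returns $v(\mathbf{x},\omega)\in\Phi(\mathbf{x},\mathbf{y}(\mathbf{x},\omega),\omega)$ with $\mathbb{E}[v(\mathbf{x},\omega)\mid\mathbf{x}]=v(\mathbf{x})\in T(\mathbf{x})$ and $\mathbb{E}[\|v(\mathbf{x},\omega)\|^2\mid\mathbf{x}]\le M_1^2\|\mathbf{x}\|^2+M_2^2$ a.s. Scheme (VR-SPP). Given $\mathbf{x}^0$, $\lambda>0$, sample sizes $N_k$ and $\theta>0$: at outer iteration $k\ge0$ set $\mathbf{z}^k_0=\mathbf{x}^k$ and, for $j=0,\dots,N_k-1$, $\mathbf{z}^k_{j+1}=\mathbf{z}^k_j-\alpha_j u^k_j$ with $u^k_j=v^k_j+\tfrac1\lambda(\mathbf{z}^k_j-\mathbf{x}^k)$,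 where $v^k_j=v(\mathbf{z}^k_j,\omega_{k,j})$ is an oracle output at $\mathbf{z}^k_j$ with fresh independent sample $\omega_{k,j}$ (so the oracle properties hold conditionally on the past), and $\alpha_j=\theta/(j+1)$. Then $\mathbf{x}^{k+1}=\mathbf{z}^k_{N_k}$; this is an approximation of the resolvent $(I+\lambda T)^{-1}(\mathbf{x}^k)$.
   Formalization: The step-size constant is required to satisfy θ > λ/(2a) instead of only θ > 0; for small θ the claim fails, e.g. T ≡ {0} on the real line with fair ±1 oracle noise and θ ≤ λ/(4a), where the iterates diverge almost surely. *)

theory Defs
  imports "HOL-Probability.Probability"
begin

section \<open>Monotone operators\<close>

text \<open>A set-valued operator is a function into sets; its domain is where the value is nonempty.\<close>

definition monotone_operator :: "('b::real_inner \<Rightarrow> 'b set) \<Rightarrow> bool" where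
  "monotone_operator T \<longleftrightarrow>
     (\<forall>x y. \<forall>u\<in>T x. \<forall>w\<in>T y. 0 \<le> (u - w) \<bullet> (x - y))"

definition maximal_monotone_operator :: "('b::real_inner \<Rightarrow> 'b set) \<Rightarrow> bool" where
  "maximal_monotone_operator T \<longleftrightarrow>
     monotone_operator T \<and>
     (\<forall>S. monotone_operator S \<longrightarrow> (\<forall>x. T x \<subseteq> S x) \<longrightarrow> S = T)"

definition zeros :: "('b::real_vector \<Rightarrow> 'b set) \<Rightarrow> 'b set" where
  "zeros T = {x. 0 \<in> T x}"

definition strongly_monotone_on :: "'b::real_inner set \<Rightarrow> ('b \<Rightarrow> 'b) \<Rightarrow> bool" where
  "strongly_monotone_on S F \<longleftrightarrow>
     (\<exists>\<mu>>0. \<forall>u\<in>S. \<forall>w\<in>S. \<mu> * (norm (u - w))\<^sup>2 \<le> (F u - F w) \<bullet> (u - w))"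

definition VI_solutions :: "'b::real_inner set \<Rightarrow> ('b \<Rightarrow> 'b) \<Rightarrow> 'b set" where
  "VI_solutions S F = {u \<in> S. \<forall>w\<in>S. 0 \<le> F u \<bullet> (w - u)}"

section \<open>Product structure\<close>

text \<open>
  The product of the Euclidean spaces of the players (of possibly different dimensions) is
  \<open>real ^ 'n\<close> together with a map \<open>own :: 'n \<Rightarrow> 'p\<close> that assigns each coordinate to a
  player. The space of player \<open>i\<close> is the coordinate subspace \<open>block own i\<close>, of dimension
  \<open>card {c. own c = i}\<close>.
\<close>

definition block :: "('n \<Rightarrow> 'p) \<Rightarrow> 'p \<Rightarrow> (real ^ 'n) set" where
  "block own i = {x. \<forall>c. own c \<noteq> i \<longrightarrow> x $ c = 0}"

definition block_proj :: "('n \<Rightarrow> 'p) \<Rightarrow> 'p \<Rightarrow> real ^ 'n \<Rightarrow> real ^ 'n" where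
  "block_proj own i x = (\<chi> c. if own c = i then x $ c else 0)"

definition block_upd :: "('n \<Rightarrow> 'p) \<Rightarrow> 'p \<Rightarrow> real ^ 'n \<Rightarrow> real ^ 'n \<Rightarrow> real ^ 'n" where
  "block_upd own i x u = (\<chi> c. if own c = i then u $ c else x $ c)"

definition block_product :: "('n \<Rightarrow> 'p) \<Rightarrow> ('p \<Rightarrow> (real ^ 'n) set) \<Rightarrow> (real ^ 'n) set" where
  "block_product own A = {x. \<forall>i. block_proj own i x \<in> A i}"

section \<open>Subdifferential, normal cone, Aumann expectation\<close>

text \<open>
  Both notions are relative to an ambient subspace \<open>V\<close>. The implicit cost is defined and convex
  only on the strategy set \<open>D\<close>, so its subdifferential is that of the convex function with
  domain \<open>D\<close>: the subgradient inequality is tested on \<open>D\<close>.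
\<close>

definition subdifferential ::
    "'b::real_inner set \<Rightarrow> 'b set \<Rightarrow> ('b \<Rightarrow> real) \<Rightarrow> 'b \<Rightarrow> 'b set" where
  "subdifferential V D h x =
     (if x \<in> D then {g \<in> V. \<forall>u\<in>D. h x + g \<bullet> (u - x) \<le> h u} else {})"

definition normal_cone :: "'b::real_inner set \<Rightarrow> 'b set \<Rightarrow> 'b \<Rightarrow> 'b set" where
  "normal_cone V D x = (if x \<in> D then {g \<in> V. \<forall>u\<in>D. g \<bullet> (u - x) \<le> 0} else {})"

definition aumann_expectation ::
    "'w measure \<Rightarrow> ('w \<Rightarrow> 'b::{banach, second_countable_topology} set) \<Rightarrow> 'b set" where
  "aumann_expectation P A =
     {integral\<^sup>L P s | s. integrable P s \<and> (AE \<omega> in P. s \<omega> \<in> A \<omega>)}"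

section \<open>The hierarchical game\<close>

text \<open>
  \<open>f i x w \<omega>\<close> is the upper-level cost of player \<open>i\<close> at the profile \<open>x\<close> and the lower-level
  decision \<open>w\<close> of that player, and \<open>y i x \<omega>\<close> is the lower-level response.
\<close>

definition implicit_cost ::
    "('p \<Rightarrow> real ^ 'n \<Rightarrow> real ^ 'm \<Rightarrow> 'w \<Rightarrow> real) \<Rightarrow> ('p \<Rightarrow> real ^ 'n \<Rightarrow> 'w \<Rightarrow> real ^ 'm) \<Rightarrow>
     'p \<Rightarrow> real ^ 'n \<Rightarrow> 'w \<Rightarrow> real" where
  "implicit_cost f y i x \<omega> = f i x (y i x \<omega>) \<omega>"

definition hierarchical_game ::
    "'w measure \<Rightarrow> ('n::finite \<Rightarrow> 'p::finite) \<Rightarrow> ('p \<Rightarrow> (real ^ 'n) set) \<Rightarrow>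
     ('m::finite \<Rightarrow> 'p) \<Rightarrow> ('p \<Rightarrow> (real ^ 'm) set) \<Rightarrow>
     ('p \<Rightarrow> real ^ 'm \<Rightarrow> real ^ 'n \<Rightarrow> 'w \<Rightarrow> real ^ 'm) \<Rightarrow>
     ('p \<Rightarrow> real ^ 'n \<Rightarrow> real ^ 'm \<Rightarrow> 'w \<Rightarrow> real) \<Rightarrow>
     ('p \<Rightarrow> real ^ 'n \<Rightarrow> 'w \<Rightarrow> real ^ 'm) \<Rightarrow> bool" where
  "hierarchical_game P own X own' Y F f y \<longleftrightarrow>
     prob_space P \<and>
     (\<forall>i. X i \<subseteq> block own i \<and> closed (X i) \<and> convex (X i)) \<and>
     (\<forall>i. Y i \<subseteq> block own' i \<and> closed (Y i) \<and> convex (Y i)) \<and>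
     (\<forall>i. \<forall>x\<in>block_product own X. \<forall>\<omega>\<in>space P.
        (\<forall>w\<in>Y i. F i w x \<omega> \<in> block own' i) \<and>
        strongly_monotone_on (Y i) (\<lambda>w. F i w x \<omega>) \<and>
        VI_solutions (Y i) (\<lambda>w. F i w x \<omega>) = {y i x \<omega>} \<and>
        convex_on (X i) (\<lambda>u. implicit_cost f y i (block_upd own i x u) \<omega>)) \<and>
     (\<forall>i. \<forall>x\<in>block_product own X. integrable P (implicit_cost f y i x))"

definition nash_equilibrium ::
    "'w measure \<Rightarrow> ('n::finite \<Rightarrow> 'p) \<Rightarrow> ('p \<Rightarrow> (real ^ 'n) set) \<Rightarrow>
     ('p \<Rightarrow> real ^ 'n \<Rightarrow> real ^ 'm \<Rightarrow> 'w \<Rightarrow> real) \<Rightarrow>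
     ('p \<Rightarrow> real ^ 'n \<Rightarrow> 'w \<Rightarrow> real ^ 'm) \<Rightarrow> real ^ 'n \<Rightarrow> bool" where
  "nash_equilibrium P own X f y x \<longleftrightarrow>
     x \<in> block_product own X \<and>
     (\<forall>i. \<forall>u\<in>X i. integral\<^sup>L P (implicit_cost f y i x)
                    \<le> integral\<^sup>L P (implicit_cost f y i (block_upd own i x u)))"

definition game_Phi ::
    "('n::finite \<Rightarrow> 'p) \<Rightarrow> ('p \<Rightarrow> (real ^ 'n) set) \<Rightarrow>
     ('p \<Rightarrow> real ^ 'n \<Rightarrow> real ^ 'm \<Rightarrow> 'w \<Rightarrow> real) \<Rightarrow>
     ('p \<Rightarrow> real ^ 'n \<Rightarrow> 'w \<Rightarrow> real ^ 'm) \<Rightarrow> real ^ 'n \<Rightarrow> 'w \<Rightarrow> (real ^ 'n) set" where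
  "game_Phi own X f y x \<omega> = block_product own (\<lambda>i.
     {g + \<nu> | g \<nu>.
        g \<in> subdifferential (block own i) (X i)
               (\<lambda>u. implicit_cost f y i (block_upd own i x u) \<omega>) (block_proj own i x) \<and>
        \<nu> \<in> normal_cone (block own i) (X i) (block_proj own i x)})"

definition game_T ::
    "'w measure \<Rightarrow> ('n::finite \<Rightarrow> 'p) \<Rightarrow> ('p \<Rightarrow> (real ^ 'n) set) \<Rightarrow>
     ('p \<Rightarrow> real ^ 'n \<Rightarrow> real ^ 'm \<Rightarrow> 'w \<Rightarrow> real) \<Rightarrow>
     ('p \<Rightarrow> real ^ 'n \<Rightarrow> 'w \<Rightarrow> real ^ 'm) \<Rightarrow> real ^ 'n \<Rightarrow> (real ^ 'n) set" where
  "game_T P own X f y x = aumann_expectation P (game_Phi own X f y x)"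

section \<open>Stochastic first-order information and the VR-SPP scheme\<close>

text \<open>
  The first-order information is specified on \<open>D\<close>, the set of points at which \<open>Phi\<close> can be nonempty.
  Since the samples of the scheme are independent of the past, the conditional moments given the
  query point are the moments at a fixed point.
\<close>

definition stochastic_oracle ::
    "'w measure \<Rightarrow> 'b::euclidean_space set \<Rightarrow> ('b \<Rightarrow> 'w \<Rightarrow> 'b set) \<Rightarrow> ('b \<Rightarrow> 'b set) \<Rightarrow>
     real \<Rightarrow> real \<Rightarrow> ('b \<Rightarrow> 'w \<Rightarrow> 'b) \<Rightarrow> bool" where
  "stochastic_oracle P D Phi T M1 M2 v \<longleftrightarrow>
     (\<lambda>(x, \<omega>). v x \<omega>) \<in> borel_measurable (borel \<Otimes>\<^sub>M P) \<and>
     (\<forall>x\<in>D.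
        (AE \<omega> in P. v x \<omega> \<in> Phi x \<omega>) \<and>
        integrable P (v x) \<and>
        integral\<^sup>L P (v x) \<in> T x \<and>
        integrable P (\<lambda>\<omega>. (norm (v x \<omega>))\<^sup>2) \<and>
        integral\<^sup>L P (\<lambda>\<omega>. (norm (v x \<omega>))\<^sup>2) \<le> M1\<^sup>2 * (norm x)\<^sup>2 + M2\<^sup>2)"

text \<open>
  Here \<open>x\<close> is the proximal centre and \<open>s\<close> the sequence of samples. The step size is
  \<open>theta / (j + 1)\<close> and the subproblem is strongly monotone with modulus \<open>1 / lam\<close>, so the
  mean-square error after \<open>n\<close> steps decays only like \<open>n powr (- 2 * theta / lam)\<close> if \<open>theta\<close> is
  small. For \<open>T = (\<lambda>_. {0})\<close> with additive noise and \<open>N k\<close> about \<open>k powr (2 * a)\<close>, the scheme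
  diverges almost surely if \<open>theta \<le> lam / (4 * a)\<close>: a lower bound on \<open>theta\<close> is unavoidable.
\<close>

primrec inner_iterate ::
    "('b::real_vector \<Rightarrow> 'w \<Rightarrow> 'b) \<Rightarrow> real \<Rightarrow> real \<Rightarrow> 'b \<Rightarrow> (nat \<Rightarrow> 'w) \<Rightarrow> nat \<Rightarrow> 'b" where
  "inner_iterate v lam theta x s 0 = x"
| "inner_iterate v lam theta x s (Suc j) =
     (let z = inner_iterate v lam theta x s j
      in z - (theta / real (j + 1)) *\<^sub>R (v z (s j) + (1 / lam) *\<^sub>R (z - x)))"

primrec vr_spp ::
    "('b::real_vector \<Rightarrow> 'w \<Rightarrow> 'b) \<Rightarrow> real \<Rightarrow> real \<Rightarrow> (nat \<Rightarrow> nat) \<Rightarrow> 'b \<Rightarrow>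
     (nat \<Rightarrow> nat \<Rightarrow> 'w) \<Rightarrow> nat \<Rightarrow> 'b" where
  "vr_spp v lam theta N x0 s 0 = x0"
| "vr_spp v lam theta N x0 s (Suc k) =
     inner_iterate v lam theta (vr_spp v lam theta N x0 s k) (s k) (N k)"

end

theory Submission
  imports Defs
begin

text \<open>
  By Minty's theorem the resolvent \<open>J\<close> of \<open>lam * T\<close> is defined everywhere; it is firmly
  nonexpansive and its fixed points are the zeros of \<open>T\<close>. The inner loop is stochastic
  approximation for the \<open>1 / lam\<close>-strongly monotone inclusion that defines \<open>J (x k)\<close>, so
  the mean-square error of \<open>x (k + 1)\<close> as an approximation of \<open>J (x k)\<close> is
  \<open>O((1 + E |x k|^2) * N k powr (- 2 * q))\<close> for every \<open>q < min (1 / 2) (theta / lam)\<close>. Because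
  \<open>theta > lam / (2 * a)\<close>, one can take \<open>2 * a * q > 1\<close>, which makes \<open>N k powr (- q)\<close> summable.
  A Gronwall argument then bounds the iterates in \<open>L\<^sup>2\<close>, hence the expected errors are summable
  and the errors are almost surely summable. This reduces the claim to a pathwise one, the
  convergence of the proximal point method with summable errors, which follows from quasi-Fejer
  monotonicity; no martingale convergence theorem is needed.
\<close>

section \<open>Minty's theorem\<close>

text \<open>
  A minimiser \<open>z\<close> of the maximum of the finitely many quadratics has \<open>0\<close> in the convex hull of the
  active gradients. Monotonicity, summed over all pairs with the convex weights, then shows that
  the minimal value is nonpositive.
\<close>

lemma finite_monotone_graph_extension:
  fixes S :: "('b::euclidean_space \<times> 'b) set" and x :: 'b
  assumes "finite S"
    and mono: "\<And>p q. p \<in> S \<Longrightarrow> q \<in> S \<Longrightarrow> 0 \<le> (snd p - snd q) \<bullet> (fst p - fst q)"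
  shows "\<exists>z. \<forall>p\<in>S. (snd p + z - x) \<bullet> (z - fst p) \<le> 0"
proof (cases "S = {}")
  case False
  define g where "g p z = (snd p + z - x) \<bullet> (z - fst p)" for p :: "'b \<times> 'b" and z
  define m where "m z = Max ((\<lambda>p. g p z) ` S)" for z
  have g_le_m: "g p z \<le> m z" if "p \<in> S" for p z
    unfolding m_def using that \<open>finite S\<close> by (intro Max_ge) auto
  have m_attained: "\<exists>p\<in>S. m z = g p z" for z
  proof -
    have "m z \<in> (\<lambda>p. g p z) ` S"
      unfolding m_def using False \<open>finite S\<close> by (intro Max_in) auto
    then show ?thesis by auto
  qed
  have g_cont: "continuous_on UNIV (g p)" for p
    unfolding g_def by (intro continuous_intros)
  have "continuous_on UNIV m"
  proof -
    have "continuous_on UNIV (\<lambda>z. Max ((\<lambda>p. g p z) ` A))" if "finite A" "A \<noteq> {}" for A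
      using that
    proof (induction A rule: finite_ne_induct)
      case (singleton p)
      then show ?case using g_cont by simp
    next
      case (insert p A)
      then have "(\<lambda>z. Max ((\<lambda>p. g p z) ` insert p A)) = (\<lambda>z. max (g p z) (Max ((\<lambda>p. g p z) ` A)))"
        by auto
      then show ?case using continuous_on_max[OF g_cont insert.IH] by (simp only:)
    qed
    then show ?thesis unfolding m_def using False \<open>finite S\<close> by blast
  qed
  obtain p0 where p0: "p0 \<in> S" using False by auto
  \<comment> \<open>The two factors of \<open>g p0\<close> vanish at \<open>x - snd p0\<close> and
    at \<open>fst p0\<close>. Completing the square at their midpoint \<open>c\<close> shows that
    \<open>g p0\<close> has bounded sublevel sets.\<close>
  define c where "c = (1/2) *\<^sub>R (fst p0 - snd p0 + x)"
  define r where "r = (norm (fst p0 + snd p0 - x))\<^sup>2 / 4"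
  have g_p0: "g p0 z = (norm (z - c))\<^sup>2 - r" for z
  proof -
    define s d where "s = z - c" and "d = (1/2) *\<^sub>R (fst p0 + snd p0 - x)"
    have "snd p0 + z - x = s + d" "z - fst p0 = s - d"
      unfolding s_def d_def c_def by (simp_all add: algebra_simps flip: scaleR_add_left)
    moreover have "r = (norm d)\<^sup>2" by (simp add: r_def d_def power_divide)
    moreover have "(s + d) \<bullet> (s - d) = (norm s)\<^sup>2 - (norm d)\<^sup>2"
      unfolding power2_norm_eq_inner by (simp add: inner_simps inner_commute)
    ultimately show ?thesis by (simp only: g_def s_def)
  qed
  \<comment> \<open>Since \<open>m\<close> dominates \<open>g p0\<close>, outside \<open>B\<close>
    it exceeds \<open>m 0\<close>. A minimiser of \<open>m\<close> over the compact set
    \<open>B\<close>, which contains 0, is therefore global.\<close>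
  define B where "B = {z. g p0 z \<le> m 0}"
  have "closed B"
    unfolding B_def using g_cont by (intro closed_Collect_le continuous_intros) auto
  moreover have "B \<subseteq> cball c (1 + (m 0 + r))"
  proof
    fix z assume "z \<in> B"
    then have *: "(norm (z - c))\<^sup>2 \<le> m 0 + r" using g_p0[of z] by (simp add: B_def)
    have "norm (z - c) \<le> 1 + (norm (z - c))\<^sup>2"
      using zero_le_power2[of "norm (z - c) - 1"] by (simp add: power2_eq_square algebra_simps)
        (smt (verit) mult_nonneg_nonneg norm_ge_zero)
    with * show "z \<in> cball c (1 + (m 0 + r))" by (simp add: dist_norm norm_minus_commute)
  qed
  ultimately have "compact B"
    by (meson bounded_cball bounded_subset compact_eq_bounded_closed)
  moreover have "0 \<in> B" unfolding B_def using g_le_m[OF p0] by auto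
  ultimately obtain z where z: "z \<in> B" "\<And>w. w \<in> B \<Longrightarrow> m z \<le> m w"
    using continuous_attains_inf[of B m] \<open>continuous_on UNIV m\<close> continuous_on_subset by blast
  have z_min: "m z \<le> m w" for w
  proof (cases "w \<in> B")
    case False
    then have "m 0 < m w" using g_le_m[OF p0, of w] by (auto simp: B_def)
    then show ?thesis using z(2)[OF \<open>0 \<in> B\<close>] by simp
  qed (use z in auto)
  have "m z \<le> 0"
  proof (rule ccontr)
    assume "\<not> m z \<le> 0"
    define I where "I = {p \<in> S. g p z = m z}"
    \<comment> \<open>\<open>G p\<close> is the gradient of \<open>g p\<close> at \<open>z\<close>,
      and \<open>g_move\<close> below is the exact second-order expansion.\<close>
    define G where "G p = (snd p + z - x) + (z - fst p)" for p
    have "finite I" using \<open>finite S\<close> by (simp add: I_def)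
    have g_move: "g p (z + s *\<^sub>R d) = g p z + s * (d \<bullet> G p) + s\<^sup>2 * (d \<bullet> d)" for p s d
      unfolding g_def G_def
      by (simp add: algebra_simps inner_simps inner_commute power2_eq_square)
    \<comment> \<open>Otherwise a hyperplane separates 0 from the active gradients, and a short move
      along \<open>-d\<close> decreases every active function. Inactive ones stay below
      \<open>m z\<close> by continuity, and finiteness of \<open>S\<close> gives one common step
      length, contradicting minimality.\<close>
    have "0 \<in> convex hull (G ` I)"
    proof (rule ccontr)
      assume "0 \<notin> convex hull (G ` I)"
      then obtain d b where "b > 0" and d: "\<And>w. w \<in> convex hull (G ` I) \<Longrightarrow> d \<bullet> w > b"
        using separating_hyperplane_closed_0[of "convex hull (G ` I)"] \<open>finite I\<close>
        by (metis convex_convex_hull compact_convex_hull compact_imp_closed finite_imageI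
            finite_imp_compact)
      have "eventually (\<lambda>s. g p (z + s *\<^sub>R (-d)) < m z) (at_right 0)" if "p \<in> S" for p
      proof (cases "p \<in> I")
        case True
        have dG: "d \<bullet> G p > 0"
          using d[of "G p"] \<open>b > 0\<close> True hull_subset[of "G ` I" convex] by force
        have "((\<lambda>s. - (d \<bullet> G p) + s * (d \<bullet> d)) \<longlongrightarrow> - (d \<bullet> G p) + 0 * (d \<bullet> d)) (at_right 0)"
          by (intro tendsto_intros)
        then have "eventually (\<lambda>s. - (d \<bullet> G p) + s * (d \<bullet> d) < 0) (at_right 0)"
          using dG by (intro order_tendstoD) auto
        moreover have "eventually (\<lambda>s::real. 0 < s) (at_right 0)"
          by (rule eventually_at_right_less)
        ultimately show ?thesis
        proof eventually_elim
          case (elim s)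
          have "g p (z + s *\<^sub>R (-d)) = m z + s * (- (d \<bullet> G p) + s * (d \<bullet> d))"
            using True unfolding g_move by (simp add: I_def algebra_simps power2_eq_square)
          also have "\<dots> < m z" using elim by (simp add: mult_pos_neg)
          finally show ?case .
        qed
      next
        case False
        then have "g p z < m z" using g_le_m[OF that, of z] that by (auto simp: I_def)
        moreover have "((\<lambda>s. g p z + s * (- d \<bullet> G p) + s\<^sup>2 * (- d \<bullet> - d))
            \<longlongrightarrow> g p z + 0 * (- d \<bullet> G p) + 0\<^sup>2 * (- d \<bullet> - d)) (at_right 0)"
          by (intro tendsto_intros)
        ultimately show ?thesis
          unfolding g_move by (intro order_tendstoD) auto
      qed
      then have "eventually (\<lambda>s. \<forall>p\<in>S. g p (z + s *\<^sub>R (-d)) < m z) (at_right 0)"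
        using \<open>finite S\<close> by (simp add: eventually_ball_finite)
      then obtain s where "\<forall>p\<in>S. g p (z + s *\<^sub>R (-d)) < m z"
        by (metis (lifting) eventually_happens trivial_limit_at_right_real)
      then have "m (z + s *\<^sub>R (-d)) < m z" using m_attained[of "z + s *\<^sub>R (-d)"] by auto
      with z_min show False by (meson not_less)
    qed
    then obtain u where u: "\<And>w. w \<in> G ` I \<Longrightarrow> 0 \<le> u w" "sum u (G ` I) = 1"
        "(\<Sum>w\<in>G ` I. u w *\<^sub>R w) = 0"
      using convex_hull_finite[of "G ` I"] \<open>finite I\<close> by auto
    \<comment> \<open>The convex weights are indexed by gradients, which several pairs may share;
      \<open>q\<close> selects one active pair for each.\<close>
    define q where "q = inv_into I G"
    define Q where "Q = G ` I"
    have q: "q w \<in> I" "G (q w) = w" if "w \<in> Q" for w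
      using that unfolding q_def Q_def by (auto intro: inv_into_into f_inv_into_f)
    define a where "a w = snd (q w) + z - x" for w
    define b where "b w = z - fst (q w)" for w
    define A where "A = (\<Sum>w\<in>Q. u w *\<^sub>R a w)"
    define B' where "B' = (\<Sum>w\<in>Q. u w *\<^sub>R b w)"
    have "A + B' = (\<Sum>w\<in>Q. u w *\<^sub>R G (q w))"
      unfolding A_def B'_def by (simp add: sum.distrib[symmetric] a_def b_def G_def scaleR_add_right)
    also have "\<dots> = 0" using u(3) q by (simp add: Q_def)
    finally have B': "B' = - A" by (simp add: eq_neg_iff_add_eq_0 add.commute)
    have ab: "a w \<bullet> b w = m z" if "w \<in> Q" for w
      using q[OF that] by (simp add: I_def g_def a_def b_def)
    \<comment> \<open>The unknown \<open>z\<close> cancels in \<open>a w - a w'\<close>, and enters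
      \<open>b w\<close> with the opposite sign to \<open>fst (q w)\<close>, so each term is a
      negated monotonicity product. Expanding the sum with \<open>a w \<bullet> b w = m z\<close>
      and \<open>B' = - A\<close> then gives \<open>m z \<le> - (A \<bullet> A)\<close>.\<close>
    have "(\<Sum>w\<in>Q. \<Sum>w'\<in>Q. (u w * u w') * ((a w - a w') \<bullet> (b w - b w'))) \<le> 0"
    proof (intro sum_nonpos mult_nonneg_nonpos mult_nonneg_nonneg)
      fix w w' assume w: "w \<in> Q" "w' \<in> Q"
      show "(a w - a w') \<bullet> (b w - b w') \<le> 0"
        using mono[of "q w" "q w'"] q(1)[OF w(1)] q(1)[OF w(2)]
        by (simp add: a_def b_def I_def inner_diff_right inner_diff_left)
    qed (use u in \<open>auto simp: Q_def\<close>)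
    moreover have "(\<Sum>w\<in>Q. \<Sum>w'\<in>Q. (u w * u w') * ((a w - a w') \<bullet> (b w - b w')))
        = 2 * m z - 2 * (A \<bullet> B')"
    proof -
      have "(\<Sum>w\<in>Q. \<Sum>w'\<in>Q. (u w * u w') * ((a w - a w') \<bullet> (b w - b w')))
          = (\<Sum>w\<in>Q. \<Sum>w'\<in>Q. u w * u w' * (2 * m z)
              - (u w *\<^sub>R a w) \<bullet> (u w' *\<^sub>R b w') - (u w' *\<^sub>R a w') \<bullet> (u w *\<^sub>R b w))"
        by (intro sum.cong refl)
          (simp add: ab inner_diff_left inner_diff_right algebra_simps)
      also have "\<dots> = (\<Sum>w\<in>Q. \<Sum>w'\<in>Q. u w * u w') * (2 * m z)
          - (\<Sum>w\<in>Q. \<Sum>w'\<in>Q. (u w *\<^sub>R a w) \<bullet> (u w' *\<^sub>R b w'))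
          - (\<Sum>w\<in>Q. \<Sum>w'\<in>Q. (u w' *\<^sub>R a w') \<bullet> (u w *\<^sub>R b w))"
        by (simp only: sum_subtractf sum_distrib_right)
      also have "(\<Sum>w\<in>Q. \<Sum>w'\<in>Q. u w * u w') = 1"
        using u(2) by (simp add: sum_product[symmetric] Q_def)
      also have "(\<Sum>w\<in>Q. \<Sum>w'\<in>Q. (u w *\<^sub>R a w) \<bullet> (u w' *\<^sub>R b w')) = A \<bullet> B'"
        unfolding A_def B'_def by (subst sum.swap) (simp only: inner_sum_left inner_sum_right)
      also have "(\<Sum>w\<in>Q. \<Sum>w'\<in>Q. (u w' *\<^sub>R a w') \<bullet> (u w *\<^sub>R b w)) = A \<bullet> B'"
        unfolding A_def B'_def by (simp only: inner_sum_left inner_sum_right)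
      finally show ?thesis by simp
    qed
    ultimately have "m z \<le> - (A \<bullet> A)" by (simp add: B')
    then show False using \<open>\<not> m z \<le> 0\<close> inner_ge_zero[of A] by linarith
  qed
  then show ?thesis using g_le_m unfolding g_def by (meson order_trans)
qed simp

text \<open>A pair that is monotonically related to the whole graph can be added to it without
  destroying monotonicity, so a maximal graph already contains it.\<close>

lemma maximal_monotone_operatorD:
  fixes T :: "'b::real_inner \<Rightarrow> 'b set"
  assumes "maximal_monotone_operator T"
    and related: "\<And>y u. u \<in> T y \<Longrightarrow> 0 \<le> (u - w) \<bullet> (y - z)"
  shows "w \<in> T z"
proof -
  have "monotone_operator (T(z := insert w (T z)))"
    unfolding monotone_operator_def
  proof (intro allI ballI)
    fix x y u u' assume "u \<in> (T(z := insert w (T z))) x" "u' \<in> (T(z := insert w (T z))) y"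
    then have "u \<in> T x \<or> u = w \<and> x = z" "u' \<in> T y \<or> u' = w \<and> y = z"
      by (auto split: if_splits)
    then show "0 \<le> (u - u') \<bullet> (x - y)"
      using assms related[of u x] related[of u' y]
      by (auto simp: maximal_monotone_operator_def monotone_operator_def inner_diff_left
          inner_diff_right algebra_simps)
  qed
  then have "T(z := insert w (T z)) = T"
    using assms(1) unfolding maximal_monotone_operator_def by auto
  then show ?thesis by (metis fun_upd_same insertI1)
qed

text \<open>The sets \<open>C p\<close> are closed, and finitely many of them meet by
  \<open>finite_monotone_graph_extension\<close>, applied to part of the graph of
  \<open>lam * T\<close>. A single one is bounded, so compactness yields a common point
  \<open>z\<close>. Membership in every \<open>C p\<close> says that
  \<open>(z, (x - z) / lam)\<close> is monotonically related to the graph of \<open>T\<close>, and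
  maximality concludes.\<close>

theorem Minty:
  fixes T :: "'b::euclidean_space \<Rightarrow> 'b set"
  assumes T: "maximal_monotone_operator T" and "lam > 0"
  shows "\<exists>z. (1 / lam) *\<^sub>R (x - z) \<in> T z"
proof -
  define Gr where "Gr = {(y, u). u \<in> T y}"
  define C where "C p = {z. (lam *\<^sub>R snd p + z - x) \<bullet> (z - fst p) \<le> 0}" for p
  have C_finite: "(\<Inter>p\<in>A. C p) \<noteq> {}" if "finite A" "A \<subseteq> Gr" for A
  proof -
    define S where "S = (\<lambda>p. (fst p, lam *\<^sub>R snd p)) ` A"
    have "0 \<le> (snd p - snd q) \<bullet> (fst p - fst q)" if pq: "p \<in> S" "q \<in> S" for p q
    proof -
      obtain p' q' where p': "p = (fst p', lam *\<^sub>R snd p')" "p' \<in> Gr"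
        and q': "q = (fst q', lam *\<^sub>R snd q')" "q' \<in> Gr"
        using pq \<open>A \<subseteq> Gr\<close> unfolding S_def by blast
      then have "0 \<le> (snd p' - snd q') \<bullet> (fst p' - fst q')"
        using T by (auto simp: maximal_monotone_operator_def monotone_operator_def Gr_def)
      then have "0 \<le> lam * ((snd p' - snd q') \<bullet> (fst p' - fst q'))"
        using \<open>lam > 0\<close> by simp
      then show ?thesis using p' q' by (simp add: scaleR_diff_right[symmetric])
    qed
    then obtain z where "\<forall>p\<in>S. (snd p + z - x) \<bullet> (z - fst p) \<le> 0"
      using finite_monotone_graph_extension[of S x] \<open>finite A\<close> by (auto simp: S_def)
    then have "z \<in> (\<Inter>p\<in>A. C p)" by (auto simp: S_def C_def)
    then show ?thesis by blast
  qed
  have "\<exists>z. \<forall>p\<in>Gr. z \<in> C p"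
  proof (cases "Gr = {}")
    case False
    then obtain p0 where p0: "p0 \<in> Gr" by auto
    have closed: "closed (C p)" for p
      unfolding C_def by (intro closed_Collect_le continuous_intros)
    have "C p0 \<subseteq> cball (fst p0) (norm (lam *\<^sub>R snd p0 + fst p0 - x))"
    proof
      fix z assume "z \<in> C p0"
      define d where "d = z - fst p0"
      define e where "e = lam *\<^sub>R snd p0 + fst p0 - x"
      have "(d + e) \<bullet> d \<le> 0" using \<open>z \<in> C p0\<close> by (simp add: C_def d_def e_def algebra_simps)
      then have "(norm d)\<^sup>2 \<le> - e \<bullet> d"
        by (simp add: power2_norm_eq_inner inner_add_left)
      also have "\<dots> \<le> norm e * norm d" using norm_cauchy_schwarz[of "-e" d] by simp
      finally have "norm d * norm d \<le> norm e * norm d" by (simp add: power2_eq_square)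
      then have "norm d \<le> norm e"
        by (cases "norm d = 0") (auto simp: mult_le_cancel_right)
      then show "z \<in> cball (fst p0) (norm (lam *\<^sub>R snd p0 + fst p0 - x))"
        by (simp add: d_def e_def dist_norm norm_minus_commute)
    qed
    then have "compact (C p0)"
      using closed by (meson bounded_cball bounded_subset compact_eq_bounded_closed)
    then have "C p0 \<inter> \<Inter> (C ` Gr) \<noteq> {}"
    proof (rule compact_imp_fip_image)
      fix A assume "finite A" "A \<subseteq> Gr"
      then show "C p0 \<inter> \<Inter> (C ` A) \<noteq> {}" using C_finite[of "insert p0 A"] p0 by auto
    qed (rule closed)
    then show ?thesis by auto
  qed simp
  then obtain z where z: "\<And>y u. u \<in> T y \<Longrightarrow> (lam *\<^sub>R u + z - x) \<bullet> (z - y) \<le> 0"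
    by (auto simp: Gr_def C_def)
  have "(1 / lam) *\<^sub>R (x - z) \<in> T z"
  proof (rule maximal_monotone_operatorD[OF T])
    fix y u assume "u \<in> T y"
    have "(u - (1 / lam) *\<^sub>R (x - z)) = (1 / lam) *\<^sub>R (lam *\<^sub>R u + z - x)"
      using \<open>lam > 0\<close> by (simp add: algebra_simps)
    moreover have "(1 / lam) * ((lam *\<^sub>R u + z - x) \<bullet> (z - y)) \<le> 0"
      using z[OF \<open>u \<in> T y\<close>] \<open>lam > 0\<close> by (intro mult_nonneg_nonpos) auto
    ultimately show "0 \<le> (u - (1 / lam) *\<^sub>R (x - z)) \<bullet> (y - z)"
      by (metis (no_types) inner_minus_right inner_scaleR_left minus_diff_eq neg_0_le_iff_le)
  qed
  then show ?thesis by blast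
qed

section \<open>The resolvent and the inexact proximal point method\<close>

text \<open>The choice is unique for a monotone \<open>T\<close> and \<open>lam > 0\<close>; a value exists by Minty's theorem
  if \<open>T\<close> is maximal.\<close>

definition resolvent :: "real \<Rightarrow> ('b::real_vector \<Rightarrow> 'b set) \<Rightarrow> 'b \<Rightarrow> 'b" where
  "resolvent lam T x = (SOME z. (1 / lam) *\<^sub>R (x - z) \<in> T z)"

context
  fixes T :: "'b::euclidean_space \<Rightarrow> 'b set" and lam :: real
  assumes T: "maximal_monotone_operator T" and lam: "lam > 0"
begin

lemma resolvent_inclusion: "(1 / lam) *\<^sub>R (x - resolvent lam T x) \<in> T (resolvent lam T x)"
  unfolding resolvent_def by (rule someI_ex) (rule Minty[OF T lam])

text \<open>Monotonicity between an arbitrary pair and the one from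
  \<open>resolvent_inclusion\<close>, multiplied by \<open>lam\<close>. Nonexpansiveness, the
  fixed-point characterisation, the decrease towards zeros and the inner-loop estimate all start
  from this form.\<close>

lemma resolvent_monotone:
  assumes "u \<in> T z"
  shows "0 \<le> (lam *\<^sub>R u - (x - resolvent lam T x)) \<bullet> (z - resolvent lam T x)"
proof -
  have "0 \<le> (u - (1 / lam) *\<^sub>R (x - resolvent lam T x)) \<bullet> (z - resolvent lam T x)"
    using T resolvent_inclusion[of x] assms
    unfolding maximal_monotone_operator_def monotone_operator_def by blast
  then have "0 \<le> lam * ((u - (1 / lam) *\<^sub>R (x - resolvent lam T x)) \<bullet> (z - resolvent lam T x))"
    using lam by simp
  also have "\<dots> = (lam *\<^sub>R (u - (1 / lam) *\<^sub>R (x - resolvent lam T x))) \<bullet> (z - resolvent lam T x)"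
    by simp
  also have "lam *\<^sub>R (u - (1 / lam) *\<^sub>R (x - resolvent lam T x)) = lam *\<^sub>R u - (x - resolvent lam T x)"
    using lam by (simp add: scaleR_diff_right)
  finally show ?thesis .
qed

text \<open>The proof passes through firm nonexpansiveness,
  \<open>d \<bullet> d \<le> (x - y) \<bullet> d\<close>, and then applies Cauchy-Schwarz.\<close>

lemma resolvent_nonexpansive: "norm (resolvent lam T x - resolvent lam T y) \<le> norm (x - y)"
proof -
  define d where "d = resolvent lam T x - resolvent lam T y"
  have "0 \<le> ((x - resolvent lam T x) - (y - resolvent lam T y)) \<bullet> d"
    using resolvent_monotone[OF resolvent_inclusion[of x], of y] lam by (simp add: d_def)
  also have "\<dots> = (x - y) \<bullet> d - d \<bullet> d" by (simp add: d_def inner_diff_left algebra_simps)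
  finally have "norm d * norm d \<le> (x - y) \<bullet> d"
    by (simp add: power2_norm_eq_inner[symmetric] power2_eq_square)
  also have "\<dots> \<le> norm (x - y) * norm d" by (rule norm_cauchy_schwarz)
  finally show ?thesis
    by (cases "norm d = 0") (auto simp: d_def[symmetric] mult_le_cancel_right)
qed

lemma continuous_on_resolvent: "continuous_on A (resolvent lam T)"
proof (rule continuous_onI)
  fix y and e :: real assume "e > 0"
  show "\<exists>d>0. \<forall>x'\<in>A. dist x' y < d \<longrightarrow> dist (resolvent lam T x') (resolvent lam T y) \<le> e"
    using \<open>e > 0\<close> resolvent_nonexpansive[of _ y]
    by (intro exI[of _ e]) (auto simp: dist_norm intro: order_trans less_imp_le)
qed

lemma resolvent_fixed_point_iff: "resolvent lam T z = z \<longleftrightarrow> z \<in> zeros T"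
proof
  assume "resolvent lam T z = z"
  then show "z \<in> zeros T" using resolvent_inclusion[of z] by (simp add: zeros_def)
next
  assume "z \<in> zeros T"
  then have "0 \<le> (lam *\<^sub>R 0 - (z - resolvent lam T z)) \<bullet> (z - resolvent lam T z)"
    by (intro resolvent_monotone) (simp add: zeros_def)
  then have "(z - resolvent lam T z) \<bullet> (z - resolvent lam T z) \<le> 0"
    by (simp add: inner_diff_left)
  then show "resolvent lam T z = z" by (simp add: power2_norm_eq_inner[symmetric])
qed

text \<open>Expanding the square around the resolvent leaves a cross term, whose sign is known
  because 0 is a value of \<open>T\<close> at \<open>z\<close>.\<close>

lemma resolvent_decrease:
  assumes "z \<in> zeros T"
  shows "(norm (resolvent lam T x - z))\<^sup>2 + (norm (x - resolvent lam T x))\<^sup>2 \<le> (norm (x - z))\<^sup>2"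
proof -
  define w where "w = resolvent lam T x"
  have "0 \<le> (lam *\<^sub>R 0 - (x - w)) \<bullet> (z - w)"
    unfolding w_def using assms by (intro resolvent_monotone) (simp add: zeros_def)
  then have "(x - w) \<bullet> (z - w) \<le> 0"
    by (simp add: inner_diff_left)
  moreover have "(norm (x - z))\<^sup>2 = (norm (w - z))\<^sup>2 + (norm (x - w))\<^sup>2 - 2 * ((x - w) \<bullet> (z - w))"
    unfolding power2_norm_eq_inner by (simp add: algebra_simps inner_commute)
  ultimately show ?thesis by (simp add: w_def)
qed

end

section \<open>Pathwise convergence under summable errors\<close>

lemma quasi_Fejer_convergent:
  fixes r e :: "nat \<Rightarrow> real"
  assumes "\<And>k. 0 \<le> r k" "\<And>k. 0 \<le> e k" "summable e" "\<And>k. r (Suc k) \<le> r k + e k"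
  shows "convergent r"
proof -
  \<comment> \<open>Subtracting the accumulated errors makes the sequence nonincreasing, while minus
    the total error bounds it below.\<close>
  define q where "q k = r k - sum e {..<k}" for k
  have "decseq q"
    using assms(4) by (intro decseq_SucI) (simp add: q_def algebra_simps)
  moreover have "- suminf e \<le> q k" for k
    using sum_le_suminf[OF assms(3), of "{..<k}"] assms(1)[of k] assms(2) by (simp add: q_def)
  ultimately obtain l where "q \<longlonglongrightarrow> l" using decseq_convergent by blast
  then have "(\<lambda>k. q k + sum e {..<k}) \<longlonglongrightarrow> l + suminf e"
    by (intro tendsto_add summable_LIMSEQ assms)
  then show ?thesis by (auto simp: q_def convergent_def)
qed

text \<open>The distance to every zero converges, and the residuals \<open>x k - J (x k)\<close>
  tend to 0. Hence a cluster point is a fixed point of \<open>J\<close>, that is, a zero. The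
  distance to this zero converges and vanishes along a subsequence, so the whole sequence converges
  to it.\<close>

theorem inexact_proximal_point_converges:
  fixes T :: "'b::euclidean_space \<Rightarrow> 'b set"
  assumes T: "maximal_monotone_operator T" and lam: "lam > 0" and "zeros T \<noteq> {}"
    and summable: "summable (\<lambda>k. norm (x (Suc k) - resolvent lam T (x k)))"
  shows "\<exists>z\<in>zeros T. x \<longlonglongrightarrow> z"
proof -
  define J where "J = resolvent lam T"
  define e where "e k = norm (x (Suc k) - J (x k))" for k
  have e: "summable e" "\<And>k. 0 \<le> e k" using summable unfolding e_def J_def by auto
  have e0: "e \<longlonglongrightarrow> 0" using e by (intro summable_LIMSEQ_zero)
  have J_le: "norm (J (x k) - z) \<le> norm (x k - z)" if "z \<in> zeros T" for z k
    using resolvent_nonexpansive[OF T lam, of "x k" z] resolvent_fixed_point_iff[OF T lam, of z] that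
    by (simp add: J_def)
  have step: "norm (x (Suc k) - z) \<le> norm (J (x k) - z) + e k" for z k
    unfolding e_def using norm_triangle_ineq[of "J (x k) - z" "x (Suc k) - J (x k)"] by simp
  have conv: "convergent (\<lambda>k. norm (x k - z))" if "z \<in> zeros T" for z
  proof (rule quasi_Fejer_convergent[OF _ e(2) e(1)])
    show "norm (x (Suc k) - z) \<le> norm (x k - z) + e k" for k
      using step[of k z] J_le[OF that, of k] by linarith
  qed simp
  obtain z0 where z0: "z0 \<in> zeros T" using \<open>zeros T \<noteq> {}\<close> by auto
  then obtain l where l: "(\<lambda>k. norm (x k - z0)) \<longlonglongrightarrow> l"
    using conv by (auto simp: convergent_def)
  \<comment> \<open>Applying \<open>J\<close> does not change the limiting distance to
    \<open>z0\<close>: the next iterate differs from \<open>J (x k)\<close> only by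
    \<open>e k\<close>. The gap in \<open>resolvent_decrease\<close> then closes, which forces the
    residual to 0.\<close>
  have "(\<lambda>k. norm (J (x k) - z0)) \<longlonglongrightarrow> l"
  proof (rule tendsto_sandwich[OF _ _ _ l])
    show "(\<lambda>k. norm (x (Suc k) - z0) - e k) \<longlonglongrightarrow> l"
      using tendsto_diff[OF LIMSEQ_Suc[OF l] e0] by simp
    show "\<forall>\<^sub>F k in sequentially. norm (x (Suc k) - z0) - e k \<le> norm (J (x k) - z0)"
      using step[of _ z0] by (intro always_eventually) (auto simp: algebra_simps)
  qed (use J_le[OF z0] in auto)
  then have "(\<lambda>k. (norm (x k - z0))\<^sup>2 - (norm (J (x k) - z0))\<^sup>2) \<longlonglongrightarrow> l\<^sup>2 - l\<^sup>2"
    by (intro tendsto_intros l)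
  then have gap: "(\<lambda>k. (norm (x k - z0))\<^sup>2 - (norm (J (x k) - z0))\<^sup>2) \<longlonglongrightarrow> 0" by simp
  have "(\<lambda>k. (norm (x k - J (x k)))\<^sup>2) \<longlonglongrightarrow> 0"
  proof (rule tendsto_sandwich[OF _ _ tendsto_const gap])
    have "(norm (x k - J (x k)))\<^sup>2 \<le> (norm (x k - z0))\<^sup>2 - (norm (J (x k) - z0))\<^sup>2" for k
      using resolvent_decrease[OF T lam z0, of "x k"] unfolding J_def by linarith
    then show "\<forall>\<^sub>F k in sequentially.
        (norm (x k - J (x k)))\<^sup>2 \<le> (norm (x k - z0))\<^sup>2 - (norm (J (x k) - z0))\<^sup>2"
      by (intro always_eventually) simp
  qed simp
  then have "(\<lambda>k. sqrt ((norm (x k - J (x k)))\<^sup>2)) \<longlonglongrightarrow> sqrt 0"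
    by (intro tendsto_intros)
  then have residual: "(\<lambda>k. x k - J (x k)) \<longlonglongrightarrow> 0" by (simp add: tendsto_norm_zero_iff)
  have "Bseq (\<lambda>k. norm (x k - z0))" using conv[OF z0] by (rule convergent_imp_Bseq)
  then obtain K where K: "\<And>k. norm (x k - z0) \<le> K" by (auto simp: Bseq_def)
  have "range x \<subseteq> cball z0 K" using K by (auto simp: dist_norm norm_minus_commute)
  then have "bounded (range x)" using bounded_cball bounded_subset by blast
  then obtain z s where s: "strict_mono s" "(x \<circ> s) \<longlonglongrightarrow> z"
    using bounded_imp_convergent_subsequence by blast
  have "(\<lambda>k. J (x (s k))) \<longlonglongrightarrow> J z"
    using continuous_on_tendsto_compose[OF continuous_on_resolvent[OF T lam, of UNIV] s(2)]
    by (simp add: J_def)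
  moreover have "(\<lambda>k. x (s k) - (x (s k) - J (x (s k)))) \<longlonglongrightarrow> z - 0"
    using s LIMSEQ_subseq_LIMSEQ[OF residual s(1)] by (intro tendsto_diff) (auto simp: o_def)
  ultimately have "J z = z" using LIMSEQ_unique by fastforce
  then have z: "z \<in> zeros T" using resolvent_fixed_point_iff[OF T lam] by (simp add: J_def)
  obtain l' where l': "(\<lambda>k. norm (x k - z)) \<longlonglongrightarrow> l'"
    using conv[OF z] by (auto simp: convergent_def)
  have "(\<lambda>k. norm (x (s k) - z)) \<longlonglongrightarrow> norm (z - z)"
    using s by (intro tendsto_intros) (auto simp: o_def)
  moreover have "(\<lambda>k. norm (x (s k) - z)) \<longlonglongrightarrow> l'"
    using LIMSEQ_subseq_LIMSEQ[OF l' s(1)] by (simp add: o_def)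
  ultimately have "l' = 0" using LIMSEQ_unique by fastforce
  then have "x \<longlonglongrightarrow> z" using l' by (metis LIM_zero_cancel tendsto_norm_zero_iff)
  then show ?thesis using z by blast
qed

section \<open>Recursive inequalities\<close>

text \<open>The recursion is required only below \<open>n\<close>, but the bound uses the full sums
  of \<open>a\<close> and \<open>b\<close> and is therefore uniform in \<open>n\<close>.\<close>

lemma discrete_Gronwall:
  fixes w a b :: "nat \<Rightarrow> real"
  assumes w: "\<And>j. 0 \<le> w j" and a: "\<And>j. 0 \<le> a j" "summable a"
    and b: "\<And>j. 0 \<le> b j" "summable b"
    and step: "\<And>j. j < n \<Longrightarrow> w (Suc j) \<le> (1 + a j) * w j + b j"
  shows "w n \<le> exp (suminf a) * (w 0 + suminf b)"
proof -
  have "w m \<le> exp (sum a {..<m}) * (w 0 + sum b {..<m})" if "m \<le> n" for m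
    using that
  proof (induction m)
    case (Suc m)
    have "w (Suc m) \<le> (1 + a m) * w m + b m" using Suc.prems by (intro step) simp
    also have "\<dots> \<le> exp (a m) * (exp (sum a {..<m}) * (w 0 + sum b {..<m}))
        + exp (sum a {..<Suc m}) * b m"
    proof (intro add_mono mult_mono Suc.IH exp_ge_add_one_self)
      have "1 \<le> exp (sum a {..<Suc m})" using a by (simp add: sum_nonneg)
      then show "b m \<le> exp (sum a {..<Suc m}) * b m"
        using mult_right_mono[of 1 _ "b m"] b by fastforce
    qed (use assms Suc.prems in auto)
    also have "\<dots> = exp (sum a {..<Suc m}) * (w 0 + sum b {..<Suc m})"
      by (simp add: exp_add algebra_simps)
    finally show ?case .
  qed simp
  then have "w n \<le> exp (sum a {..<n}) * (w 0 + sum b {..<n})" by simp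
  also have "\<dots> \<le> exp (suminf a) * (w 0 + suminf b)"
    using assms by (intro mult_mono add_mono sum_le_suminf) (auto intro!: sum_nonneg add_nonneg_nonneg sum_le_suminf)
  finally show ?thesis .
qed

lemma summable_Suc_powr:
  assumes "s < -1"
  shows "summable (\<lambda>j. real (Suc j) powr s)"
proof -
  have "summable (\<lambda>j. real j powr s)" using assms by (simp add: summable_real_powr_iff)
  then show ?thesis by (subst (asm) summable_Suc_iff[symmetric])
qed

text \<open>Bernoulli's inequality \<open>(1 + 1 / t) powr p \<le> 1 + p / t\<close> for exponents
  in [0, 1], obtained from the weighted arithmetic-geometric mean inequality.\<close>

lemma Suc_powr_le:
  assumes "0 \<le> p" "p \<le> 1"
  shows "real (Suc (Suc j)) powr p \<le> (1 + p / real (Suc j)) * real (Suc j) powr p"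
proof -
  have "(1 + 1 / real (Suc j)) powr p * 1 powr (1 - p) \<le> p * (1 + 1 / real (Suc j)) + (1 - p) * 1"
    using assms by (intro Youngs_inequality_0) (auto intro: add_pos_nonneg)
  then have "(1 + 1 / real (Suc j)) powr p \<le> 1 + p / real (Suc j)" by (simp add: algebra_simps)
  then have "(1 + 1 / real (Suc j)) powr p * real (Suc j) powr p
      \<le> (1 + p / real (Suc j)) * real (Suc j) powr p"
    by (intro mult_right_mono) auto
  moreover have "(1 + 1 / real (Suc j)) * real (Suc j) = real (Suc (Suc j))"
    by (simp add: field_simps)
  ultimately show ?thesis by (simp only: powr_mult[symmetric])
qed

text \<open>The substitution \<open>w j = (j + 1) powr p * e j\<close> removes the \<open>1 / (j + 1)\<close> term
  because \<open>p \<le> c\<close>, and leaves a summable perturbation because \<open>p < 1\<close>.\<close>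

lemma recursion_powr_decay:
  fixes p c C :: real
  assumes p: "0 \<le> p" "p < 1" "p \<le> c" and C: "c\<^sup>2 \<le> C"
  obtains K where "0 \<le> K" "\<And>e B n. \<lbrakk>\<And>j. 0 \<le> e j; 0 \<le> B;
      \<And>j. j < n \<Longrightarrow> e (Suc j) \<le> (1 - c / real (Suc j) + C / (real (Suc j))\<^sup>2) * e j
        + C / (real (Suc j))\<^sup>2 * B\<rbrakk>
      \<Longrightarrow> e n \<le> K * (e 0 + B) * real (Suc n) powr (- p)"
proof -
  \<comment> \<open>The factor 2 bounds \<open>1 + p / t\<close> for \<open>t \<ge> 1\<close>. The
    exponent \<open>p - 2\<close> in \<open>b\<close> is below -1 exactly because
    \<open>p < 1\<close>. Both sequences are fixed before \<open>e\<close>, \<open>B\<close> and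
    \<open>n\<close>, which makes \<open>K\<close> uniform in them.\<close>
  define a where "a j = 2 * C * real (Suc j) powr (- 2)" for j
  define b where "b j = 2 * C * real (Suc j) powr (p - 2)" for j
  have "0 \<le> C" using C zero_le_power2[of c] by linarith
  have ab: "summable a" "summable b" "\<And>j. 0 \<le> a j" "\<And>j. 0 \<le> b j"
    using p \<open>0 \<le> C\<close> unfolding a_def b_def by (auto intro!: summable_mult summable_Suc_powr simp del: of_nat_Suc)
  define K where "K = exp (suminf a) * (1 + suminf b)"
  have "0 \<le> suminf b" using ab by (simp add: suminf_nonneg)
  then have "0 \<le> K" by (simp add: K_def)
  moreover have "e n \<le> K * (e 0 + B) * real (Suc n) powr (- p)"
    if e: "\<And>j. 0 \<le> e j" and B: "0 \<le> B"
      and step: "\<And>j. j < n \<Longrightarrow> e (Suc j) \<le> (1 - c / real (Suc j) + C / (real (Suc j))\<^sup>2) * e j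
        + C / (real (Suc j))\<^sup>2 * B" for e B n
  proof -
    define w where "w j = real (Suc j) powr p * e j" for j
    have "w n \<le> exp (suminf a) * (w 0 + (\<Sum>j. b j * B))"
    proof (rule discrete_Gronwall)
      show "summable (\<lambda>j. b j * B)" using ab by (intro summable_mult2)
      fix j assume "j < n"
      define t where "t = real (Suc j)"
      have t: "1 \<le> t" by (simp add: t_def)
      have pos: "0 \<le> 1 - c / t + C / t\<^sup>2"
      proof -
        have "0 \<le> (1 - c / t / 2)\<^sup>2 + 3 / 4 * (c / t)\<^sup>2" by simp
        also have "\<dots> = 1 - c / t + c\<^sup>2 / t\<^sup>2" by (simp add: power2_diff power_divide)
        also have "\<dots> \<le> 1 - c / t + C / t\<^sup>2" using C by (simp add: divide_right_mono)
        finally show ?thesis .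
      qed
      have "w (Suc j) \<le> ((1 + p / t) * t powr p) * ((1 - c / t + C / t\<^sup>2) * e j + C / t\<^sup>2 * B)"
        unfolding w_def
        using Suc_powr_le[of p j] p step[OF \<open>j < n\<close>] e[of "Suc j"] t
        by (intro mult_mono) (auto simp: t_def)
      also have "\<dots> = ((1 + p / t) * (1 - c / t + C / t\<^sup>2)) * w j + (1 + p / t) * (C * (t powr p / t\<^sup>2)) * B"
        unfolding w_def t_def[symmetric] by (simp add: divide_inverse algebra_simps)
      also have "\<dots> \<le> (1 + a j) * w j + b j * B"
      proof (intro add_mono mult_right_mono B)
        have powr2: "t powr (-2) = 1 / t\<^sup>2" using t by (simp add: powr_minus_divide)
        have "(1 + p / t) * (1 - c / t + C / t\<^sup>2)
            = 1 + (p - c) / t - p * c / t\<^sup>2 + (1 + p / t) * (C / t\<^sup>2)"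
          using t by (simp add: field_simps power2_eq_square)
        also have "\<dots> \<le> 1 + 0 - 0 + 2 * (C / t\<^sup>2)"
          using p t \<open>0 \<le> C\<close>
          by (intro add_mono diff_mono mult_right_mono)
            (auto simp: divide_nonpos_pos divide_le_eq)
        finally show "(1 + p / t) * (1 - c / t + C / t\<^sup>2) \<le> 1 + a j"
          using powr2 by (simp add: a_def t_def)
        have "t powr (p - 2) = t powr p / t\<^sup>2" using t by (simp add: powr_diff)
        moreover have "(1 + p / t) * (C * (t powr p / t\<^sup>2)) \<le> 2 * (C * (t powr p / t\<^sup>2))"
          using p t \<open>0 \<le> C\<close> by (intro mult_right_mono) (auto simp: divide_le_eq)
        ultimately show "(1 + p / t) * (C * (t powr p / t\<^sup>2)) \<le> b j"
          by (simp add: b_def t_def)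
        show "0 \<le> w j" using e by (simp add: w_def)
      qed
      finally show "w (Suc j) \<le> (1 + a j) * w j + b j * B" .
    qed (use ab e B in \<open>auto simp: w_def\<close>)
    also have "\<dots> = exp (suminf a) * (e 0 + suminf b * B)"
      using ab suminf_mult2[of b B] by (simp add: w_def)
    also have "\<dots> \<le> exp (suminf a) * ((1 + suminf b) * (e 0 + B))"
      using \<open>0 \<le> suminf b\<close> e[of 0] B by (intro mult_left_mono) (auto simp: algebra_simps)
    finally have "w n \<le> K * (e 0 + B)" by (simp add: K_def)
    then show ?thesis by (simp add: w_def powr_minus field_simps)
  qed
  ultimately show thesis using that by blast
qed

section \<open>Sampling\<close>

text \<open>\<open>W\<close> is a function of the samples with index in \<open>A\<close>, hence independent of \<open>X i\<close>, and can be
  kept fixed while \<open>X i\<close> is integrated out.\<close>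

lemma (in prob_space) expectation_freeze_le:
  fixes X :: "'i \<Rightarrow> 'a \<Rightarrow> 'w" and h :: "'c \<Rightarrow> 'w \<Rightarrow> real"
  assumes indep: "indep_vars (\<lambda>_. P) X I" and A: "A \<subseteq> I" and i: "i \<in> I" "i \<notin> A"
    and law: "distr M P (X i) = P"
    and h: "(\<lambda>(w, y). h w y) \<in> borel_measurable (N \<Otimes>\<^sub>M P)" "\<And>w y. 0 \<le> h w y"
    and G: "G \<in> measurable (PiM A (\<lambda>_. P)) N"
    and W: "\<And>\<omega>. W \<omega> = G (restrict (\<lambda>i. X i \<omega>) A)"
    and bound: "AE \<omega> in M. integrable P (h (W \<omega>)) \<and> integral\<^sup>L P (h (W \<omega>)) \<le> g (W \<omega>)"
    and g: "integrable M (\<lambda>\<omega>. g (W \<omega>))"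
  shows "integrable M (\<lambda>\<omega>. h (W \<omega>) (X i \<omega>)) \<and>
    expectation (\<lambda>\<omega>. h (W \<omega>) (X i \<omega>)) \<le> expectation (\<lambda>\<omega>. g (W \<omega>))"
proof -
  let ?S = "PiM A (\<lambda>_. P)" and ?R = "PiM {i} (\<lambda>_. P)"
  define RA where "RA \<omega> = restrict (\<lambda>i. X i \<omega>) A" for \<omega>
  \<comment> \<open>Independence is used between restrictions of the family to disjoint index sets,
    so \<open>X i\<close> enters as a family indexed by \<open>{i}\<close>, and \<open>H\<close>
    reads its only coordinate.\<close>
  define RB where "RB \<omega> = restrict (\<lambda>i. X i \<omega>) {i}" for \<omega>
  define H where "H p = ennreal (h (G (fst p)) (snd p i))" for p :: "('i \<Rightarrow> 'w) \<times> ('i \<Rightarrow> 'w)"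
  have iv: "indep_var ?S RA ?R RB"
    unfolding RA_def RB_def using i A by (intro indep_var_restrict[OF indep]) auto
  have RA: "RA \<in> measurable M ?S" and RB: "RB \<in> measurable M ?R"
    using iv indep_var_rv1 indep_var_rv2 by blast+
  have Xi: "X i \<in> measurable M P" using indep i unfolding indep_vars_def by auto
  have W_eq: "W \<omega> = G (RA \<omega>)" for \<omega> by (simp add: W RA_def)
  have W_meas: "W \<in> measurable M N" using measurable_compose[OF RA G] by (simp add: W_eq[abs_def])
  have hm: "(\<lambda>p. h (fst p) (snd p)) \<in> borel_measurable (N \<Otimes>\<^sub>M P)"
    using h(1) by (simp add: case_prod_beta)
  have "(\<lambda>p. (G (fst p), snd p i)) \<in> measurable (?S \<Otimes>\<^sub>M ?R) (N \<Otimes>\<^sub>M P)"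
    using G by (intro measurable_Pair measurable_compose[OF measurable_fst]
        measurable_compose[OF measurable_snd] measurable_component_singleton) auto
  from measurable_compose[OF this hm] have H_meas: "H \<in> borel_measurable (?S \<Otimes>\<^sub>M ?R)"
    unfolding H_def by simp
  interpret D: prob_space "distr M ?R RB" using RB by (rule prob_space_distr)
  have h_meas: "(\<lambda>\<omega>. h (W \<omega>) (X i \<omega>)) \<in> borel_measurable M"
    using measurable_compose[OF measurable_Pair[OF W_meas Xi] hm] by simp
  \<comment> \<open>Integrability of the left side is part of the claim, so the computation uses
    nonnegative integrals. By independence the joint law of \<open>RA\<close> and \<open>RB\<close>
    is a product, and Tonelli's theorem integrates out \<open>RB\<close> first.\<close>
  have "(\<integral>\<^sup>+\<omega>. ennreal (h (W \<omega>) (X i \<omega>)) \<partial>M) = (\<integral>\<^sup>+\<omega>. H (RA \<omega>, RB \<omega>) \<partial>M)"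
    by (simp add: H_def W_eq RB_def)
  also have "\<dots> = integral\<^sup>N (distr M (?S \<Otimes>\<^sub>M ?R) (\<lambda>\<omega>. (RA \<omega>, RB \<omega>))) H"
    using RA RB H_meas by (intro nn_integral_distr[symmetric]) auto
  also have "\<dots> = integral\<^sup>N (distr M ?S RA \<Otimes>\<^sub>M distr M ?R RB) H"
    using iv unfolding indep_var_distribution_eq by simp
  also have "\<dots> = (\<integral>\<^sup>+\<sigma>. \<integral>\<^sup>+\<tau>. H (\<sigma>, \<tau>) \<partial>distr M ?R RB \<partial>distr M ?S RA)"
    using H_meas by (intro D.nn_integral_fst[symmetric]) (simp cong: measurable_cong_sets)
  also have "\<dots> = (\<integral>\<^sup>+\<omega>. \<integral>\<^sup>+\<tau>. H (RA \<omega>, \<tau>) \<partial>distr M ?R RB \<partial>M)"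
    using RA H_meas
    by (intro nn_integral_distr RA) (simp cong: measurable_cong_sets add: D.borel_measurable_nn_integral_fst)
  also have "\<dots> = (\<integral>\<^sup>+\<omega>. \<integral>\<^sup>+y. ennreal (h (W \<omega>) y) \<partial>P \<partial>M)"
  proof (intro nn_integral_cong)
    fix \<omega> assume \<omega>: "\<omega> \<in> space M"
    have "W \<omega> \<in> space N" "RA \<omega> \<in> space ?S"
      using measurable_space[OF W_meas \<omega>] measurable_space[OF RA \<omega>] by auto
    have "(\<integral>\<^sup>+\<tau>. H (RA \<omega>, \<tau>) \<partial>distr M ?R RB) = (\<integral>\<^sup>+\<omega>'. H (RA \<omega>, RB \<omega>') \<partial>M)"
      using RB measurable_compose[OF measurable_Pair1'[OF \<open>RA \<omega> \<in> space ?S\<close>] H_meas]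
      by (intro nn_integral_distr) auto
    also have "\<dots> = (\<integral>\<^sup>+\<omega>'. ennreal (h (W \<omega>) (X i \<omega>')) \<partial>M)"
      by (simp add: H_def W_eq RB_def)
    also have "\<dots> = integral\<^sup>N (distr M P (X i)) (\<lambda>y. ennreal (h (W \<omega>) y))"
      using Xi measurable_compose[OF measurable_Pair1'[OF \<open>W \<omega> \<in> space N\<close>] hm]
      by (intro nn_integral_distr[symmetric]) auto
    finally show "(\<integral>\<^sup>+\<tau>. H (RA \<omega>, \<tau>) \<partial>distr M ?R RB) = (\<integral>\<^sup>+y. ennreal (h (W \<omega>) y) \<partial>P)"
      by (simp only: law)
  qed
  also have "\<dots> \<le> (\<integral>\<^sup>+\<omega>. ennreal (g (W \<omega>)) \<partial>M)"
  proof (rule nn_integral_mono_AE)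
    show "AE \<omega> in M. (\<integral>\<^sup>+y. ennreal (h (W \<omega>) y) \<partial>P) \<le> ennreal (g (W \<omega>))"
      using bound by eventually_elim (simp add: nn_integral_eq_integral ennreal_leI h(2))
  qed
  also have "\<dots> = ennreal (expectation (\<lambda>\<omega>. g (W \<omega>)))"
  proof (rule nn_integral_eq_integral[OF g])
    \<comment> \<open>The sign of \<open>g\<close> comes from \<open>bound\<close>: almost surely it
      dominates the integral of a nonnegative function.\<close>
    show "AE \<omega> in M. 0 \<le> g (W \<omega>)"
      using bound by eventually_elim (meson Bochner_Integration.integral_nonneg h(2) order_trans)
  qed
  finally have le: "(\<integral>\<^sup>+\<omega>. ennreal (h (W \<omega>) (X i \<omega>)) \<partial>M) \<le> ennreal (expectation (\<lambda>\<omega>. g (W \<omega>)))" .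
  then have int: "integrable M (\<lambda>\<omega>. h (W \<omega>) (X i \<omega>))"
    using h(2) h_meas by (intro integrableI_nonneg) (auto intro: le_less_trans)
  moreover have "0 \<le> expectation (\<lambda>\<omega>. g (W \<omega>))"
  proof (rule integral_nonneg_AE)
    show "AE \<omega> in M. 0 \<le> g (W \<omega>)"
      using bound by eventually_elim (meson Bochner_Integration.integral_nonneg h(2) order_trans)
  qed
  ultimately show ?thesis
    using le h(2) by (simp add: nn_integral_eq_integral)
qed

text \<open>Here \<open>d\<close> is the displacement from the target and \<open>c\<close> the
  deterministic part of the direction. In the expanded square the linear term sees only the mean of
  \<open>v\<close>, where \<open>mono\<close> applies; the quadratic term is split between
  \<open>v\<close> and \<open>c\<close> by \<open>|v + c|^2 \<le> 2 |v|^2 + 2 |c|^2\<close>.\<close>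

lemma (in prob_space) stochastic_step_bound:
  fixes v :: "'a \<Rightarrow> 'b::euclidean_space"
  assumes v: "integrable M v" "integrable M (\<lambda>\<omega>. (norm (v \<omega>))\<^sup>2)"
      "expectation (\<lambda>\<omega>. (norm (v \<omega>))\<^sup>2) \<le> m"
    and alpha: "0 \<le> \<alpha>"
    and mono: "\<mu> * (norm d)\<^sup>2 \<le> (expectation v + c) \<bullet> d"
  shows "integrable M (\<lambda>\<omega>. (norm (d - \<alpha> *\<^sub>R (v \<omega> + c)))\<^sup>2) \<and>
    expectation (\<lambda>\<omega>. (norm (d - \<alpha> *\<^sub>R (v \<omega> + c)))\<^sup>2)
      \<le> (1 - 2 * \<alpha> * \<mu>) * (norm d)\<^sup>2 + \<alpha>\<^sup>2 * (2 * m + 2 * (norm c)\<^sup>2)"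
proof -
  have eq: "(norm (d - \<alpha> *\<^sub>R (v \<omega> + c)))\<^sup>2 = (norm d)\<^sup>2 - 2 * \<alpha> * (v \<omega> \<bullet> d) - 2 * \<alpha> * (c \<bullet> d)
      + \<alpha>\<^sup>2 * ((norm (v \<omega>))\<^sup>2 + 2 * (v \<omega> \<bullet> c) + (norm c)\<^sup>2)" for \<omega>
    unfolding power2_norm_eq_inner
    by (simp add: inner_simps inner_commute algebra_simps power2_eq_square)
  have int: "integrable M (\<lambda>\<omega>. (norm (d - \<alpha> *\<^sub>R (v \<omega> + c)))\<^sup>2)"
    unfolding eq using v by simp
  have le: "(norm (d - \<alpha> *\<^sub>R (v \<omega> + c)))\<^sup>2 \<le> (norm d)\<^sup>2 - 2 * \<alpha> * (v \<omega> \<bullet> d) - 2 * \<alpha> * (c \<bullet> d)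
      + \<alpha>\<^sup>2 * (2 * (norm (v \<omega>))\<^sup>2 + 2 * (norm c)\<^sup>2)" for \<omega>
  proof -
    have "0 \<le> (norm (v \<omega> - c))\<^sup>2" by simp
    then have "(norm (v \<omega>))\<^sup>2 + 2 * (v \<omega> \<bullet> c) + (norm c)\<^sup>2 \<le> 2 * (norm (v \<omega>))\<^sup>2 + 2 * (norm c)\<^sup>2"
      unfolding power2_norm_eq_inner by (simp add: inner_simps inner_commute)
    then show ?thesis unfolding eq by (intro add_left_mono mult_left_mono) auto
  qed
  have "expectation (\<lambda>\<omega>. (norm (d - \<alpha> *\<^sub>R (v \<omega> + c)))\<^sup>2)
      \<le> expectation (\<lambda>\<omega>. (norm d)\<^sup>2 - 2 * \<alpha> * (v \<omega> \<bullet> d) - 2 * \<alpha> * (c \<bullet> d)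
      + \<alpha>\<^sup>2 * (2 * (norm (v \<omega>))\<^sup>2 + 2 * (norm c)\<^sup>2))"
    using int v le by (intro integral_mono) auto
  also have "\<dots> = (norm d)\<^sup>2 - 2 * \<alpha> * ((expectation v + c) \<bullet> d)
      + \<alpha>\<^sup>2 * (2 * expectation (\<lambda>\<omega>. (norm (v \<omega>))\<^sup>2) + 2 * (norm c)\<^sup>2)"
    using v by (simp add: prob_space inner_add_left algebra_simps)
  also have "\<dots> \<le> (norm d)\<^sup>2 - 2 * \<alpha> * (\<mu> * (norm d)\<^sup>2) + \<alpha>\<^sup>2 * (2 * m + 2 * (norm c)\<^sup>2)"
    using v(3) alpha mono by (intro add_mono diff_mono mult_left_mono) auto
  also have "\<dots> = (1 - 2 * \<alpha> * \<mu>) * (norm d)\<^sup>2 + \<alpha>\<^sup>2 * (2 * m + 2 * (norm c)\<^sup>2)"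
    by (simp add: algebra_simps)
  finally show ?thesis using int by blast
qed

text \<open>Young's inequality with a free weight. The choice \<delta> = 1 gives the crude factor 2;
  a small \<delta> keeps the coefficient of the first term near 1, as the outer recursion
  requires.\<close>

lemma norm_add_power2_le:
  fixes a b :: "'b::real_inner"
  assumes "0 < \<delta>"
  shows "(norm (a + b))\<^sup>2 \<le> (1 + \<delta>) * (norm a)\<^sup>2 + (1 + 1 / \<delta>) * (norm b)\<^sup>2"
proof -
  have "0 \<le> (1 / \<delta>) * (norm (\<delta> *\<^sub>R a - b))\<^sup>2" using assms by simp
  also have "\<dots> = \<delta> * (norm a)\<^sup>2 + (1 / \<delta>) * (norm b)\<^sup>2 - 2 * (a \<bullet> b)"
    unfolding power2_norm_eq_inner using assms
    by (simp add: inner_simps inner_commute field_simps)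
  finally show ?thesis
    unfolding power2_norm_eq_inner by (simp add: inner_simps inner_commute algebra_simps)
qed

section \<open>Measurability of the iterates and their dependence on the samples\<close>

lemma measurable_inner_iterate:
  fixes v :: "'b::euclidean_space \<Rightarrow> 'w \<Rightarrow> 'b"
  assumes v: "(\<lambda>(x, \<omega>). v x \<omega>) \<in> borel_measurable (borel \<Otimes>\<^sub>M P)"
    and x: "x \<in> borel_measurable S"
    and s: "\<And>j. j < n \<Longrightarrow> s j \<in> measurable S P"
  shows "(\<lambda>\<omega>. inner_iterate v lam theta (x \<omega>) (\<lambda>j. s j \<omega>) n) \<in> borel_measurable S"
  using s
proof (induction n)
  case (Suc n)
  then have z: "(\<lambda>\<omega>. inner_iterate v lam theta (x \<omega>) (\<lambda>j. s j \<omega>) n) \<in> borel_measurable S"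
    and sn: "s n \<in> measurable S P" by auto
  have "(\<lambda>\<omega>. v (inner_iterate v lam theta (x \<omega>) (\<lambda>j. s j \<omega>) n) (s n \<omega>)) \<in> borel_measurable S"
    using measurable_compose[OF measurable_Pair[OF z sn] v] by simp
  then show ?case
    unfolding inner_iterate.simps Let_def using z x by measurable
qed (use x in simp)

lemma measurable_vr_spp:
  fixes v :: "'b::euclidean_space \<Rightarrow> 'w \<Rightarrow> 'b"
  assumes v: "(\<lambda>(x, \<omega>). v x \<omega>) \<in> borel_measurable (borel \<Otimes>\<^sub>M P)"
    and s: "\<And>i j. i < k \<Longrightarrow> j < N i \<Longrightarrow> s i j \<in> measurable S P"
  shows "(\<lambda>\<omega>. vr_spp v lam theta N x0 (\<lambda>i j. s i j \<omega>) k) \<in> borel_measurable S"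
  using s
proof (induction k)
  case (Suc k)
  then show ?case by (auto intro!: measurable_inner_iterate[OF v])
qed simp

lemma inner_iterate_cong:
  assumes "\<And>j. j < n \<Longrightarrow> s j = s' j"
  shows "inner_iterate v lam theta x s n = inner_iterate v lam theta x s' n"
  using assms by (induction n) (auto simp: Let_def)

text \<open>This allows an iterate to be written as a function of the samples already drawn, which
  the independence argument needs.\<close>

lemma vr_spp_cong:
  assumes "\<And>i j. i < k \<Longrightarrow> j < N i \<Longrightarrow> s i j = s' i j"
  shows "vr_spp v lam theta N x0 s k = vr_spp v lam theta N x0 s' k"
  using assms by (induction k) (auto intro: inner_iterate_cong)

section \<open>Moments of the scheme\<close>

text \<open>The scheme for an abstract operator. \<open>D\<close> is the set on which the moment
  conditions of the oracle are given, and \<open>queries\<close> places the points at which it is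
  evaluated there, almost surely.\<close>

locale sampled_vr_spp = prob_space M for M :: "'a measure" +
  fixes P :: "'w measure" and T :: "'b::euclidean_space \<Rightarrow> 'b set" and D :: "'b set"
    and Phi :: "'b \<Rightarrow> 'w \<Rightarrow> 'b set" and M1 M2 lam theta :: real
    and v :: "'b \<Rightarrow> 'w \<Rightarrow> 'b" and N :: "nat \<Rightarrow> nat" and \<xi> :: "nat \<Rightarrow> nat \<Rightarrow> 'a \<Rightarrow> 'w"
    and x0 :: 'b
  assumes P: "prob_space P"
    and T: "maximal_monotone_operator T" and zeros: "zeros T \<noteq> {}"
    and lam: "lam > 0" and theta: "theta > 0"
    and first_order_info: "stochastic_oracle P D Phi T M1 M2 v"
    and indep: "indep_vars (\<lambda>_. P) (\<lambda>(k, j). \<xi> k j) {(k, j). j < N k}"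
    and law: "\<And>k j. j < N k \<Longrightarrow> distr M P (\<xi> k j) = P"
    and queries: "AE \<omega> in M. \<forall>k. \<forall>j<N k.
      inner_iterate v lam theta (vr_spp v lam theta N x0 (\<lambda>k j. \<xi> k j \<omega>) k) (\<lambda>j. \<xi> k j \<omega>) j \<in> D"
begin

abbreviation J :: "'b \<Rightarrow> 'b" where "J \<equiv> resolvent lam T"

definition x :: "nat \<Rightarrow> 'a \<Rightarrow> 'b" where
  "x k \<omega> = vr_spp v lam theta N x0 (\<lambda>k j. \<xi> k j \<omega>) k"

definition z :: "nat \<Rightarrow> nat \<Rightarrow> 'a \<Rightarrow> 'b" where
  "z k j \<omega> = inner_iterate v lam theta (x k \<omega>) (\<lambda>j. \<xi> k j \<omega>) j"

text \<open>Centre and current point are explicit arguments, so that one step can be estimated at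
  fixed values before the random ones are substituted.\<close>

definition step :: "nat \<Rightarrow> 'b \<Rightarrow> 'b \<Rightarrow> 'w \<Rightarrow> 'b" where
  "step j c u y = u - (theta / real (Suc j)) *\<^sub>R (v u y + (1 / lam) *\<^sub>R (u - c))"

lemma x_0: "x 0 \<omega> = x0" by (simp add: x_def)

lemma x_Suc: "x (Suc k) \<omega> = z k (N k) \<omega>" by (simp add: x_def z_def)

lemma z_0: "z k 0 \<omega> = x k \<omega>" by (simp add: z_def)

lemma z_Suc: "z k (Suc j) \<omega> = step j (x k \<omega>) (z k j \<omega>) (\<xi> k j \<omega>)"
  by (simp add: z_def step_def Let_def)

lemma v_measurable: "(\<lambda>(x, \<omega>). v x \<omega>) \<in> borel_measurable (borel \<Otimes>\<^sub>M P)"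
  using first_order_info by (simp add: stochastic_oracle_def)

lemma \<xi>_measurable: "j < N k \<Longrightarrow> \<xi> k j \<in> measurable M P"
  using indep unfolding indep_vars_def by fastforce

lemma x_measurable [measurable]: "x k \<in> borel_measurable M"
  unfolding x_def[abs_def] by (rule measurable_vr_spp[OF v_measurable]) (rule \<xi>_measurable)

lemma z_measurable: "j \<le> N k \<Longrightarrow> z k j \<in> borel_measurable M"
  unfolding z_def[abs_def] by (rule measurable_inner_iterate[OF v_measurable]) (auto intro: \<xi>_measurable)

lemma J_measurable [measurable]: "J \<in> borel_measurable borel"
  by (intro borel_measurable_continuous_onI continuous_on_resolvent T lam)

lemma norm_J_power2_le: "(norm (J c))\<^sup>2 \<le> 2 * (norm c)\<^sup>2 + 2 * (norm (J 0))\<^sup>2"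
proof -
  have "(norm (J c))\<^sup>2 = (norm ((J c - J 0) + J 0))\<^sup>2" by simp
  also have "\<dots> \<le> 2 * (norm (J c - J 0))\<^sup>2 + 2 * (norm (J 0))\<^sup>2"
    using norm_add_power2_le[of 1 "J c - J 0" "J 0"] by simp
  also have "(norm (J c - J 0))\<^sup>2 \<le> (norm c)\<^sup>2"
    using resolvent_nonexpansive[OF T lam, of c 0] by (intro power_mono) auto
  finally show ?thesis by simp
qed

text \<open>The first two summands dominate the coefficients of the squared error and of
  \<open>(norm c)\<^sup>2\<close> in \<open>direction_growth\<close>; the other three are the
  constant part of that estimate.\<close>

definition growth :: real where
  "growth = 8 * M1\<^sup>2 + 24 / lam\<^sup>2 + 2 * M2\<^sup>2 + 8 * M1\<^sup>2 * (norm (J 0))\<^sup>2 + 16 / lam\<^sup>2 * (norm (J 0))\<^sup>2"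

text \<open>Writing \<open>u\<close> as \<open>(u - J c) + J c\<close> expresses the state-dependent
  moment bound and the proximal term through the quantity tracked by the inner recursion, the
  squared distance to \<open>J c\<close>, and through the centre.\<close>

lemma direction_growth:
  "2 * (M1\<^sup>2 * (norm u)\<^sup>2 + M2\<^sup>2) + 2 * (norm ((1 / lam) *\<^sub>R (u - c)))\<^sup>2
    \<le> growth * ((norm (u - J c))\<^sup>2 + (1 + (norm c)\<^sup>2))"
proof -
  define e r s i where "e = (norm (u - J c))\<^sup>2" and "r = (norm (J 0))\<^sup>2" and "s = (norm c)\<^sup>2"
    and "i = 1 / lam\<^sup>2"
  note defs = e_def r_def s_def i_def
  have nonneg: "0 \<le> e" "0 \<le> r" "0 \<le> s" "0 \<le> i" by (auto simp: defs)
  have Jc: "(norm (J c))\<^sup>2 \<le> 2 * s + 2 * r" using norm_J_power2_le[of c] by (simp add: defs)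
  have u: "(norm u)\<^sup>2 \<le> 2 * e + 4 * s + 4 * r"
    using norm_add_power2_le[of 1 "u - J c" "J c"] Jc by (simp add: defs)
  have "(norm (J c - c))\<^sup>2 \<le> 2 * (norm (J c))\<^sup>2 + 2 * s"
    using norm_add_power2_le[of 1 "J c" "-c"] by (simp add: defs)
  then have d: "(norm (u - c))\<^sup>2 \<le> 2 * e + 12 * s + 8 * r"
    using norm_add_power2_le[of 1 "u - J c" "J c - c"] Jc by (simp add: defs)
  have "(norm ((1 / lam) *\<^sub>R (u - c)))\<^sup>2 = i * (norm (u - c))\<^sup>2"
    using lam by (simp add: defs power_divide)
  then have "2 * (M1\<^sup>2 * (norm u)\<^sup>2 + M2\<^sup>2) + 2 * (norm ((1 / lam) *\<^sub>R (u - c)))\<^sup>2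
      \<le> 2 * (M1\<^sup>2 * (2 * e + 4 * s + 4 * r) + M2\<^sup>2) + 2 * (i * (2 * e + 12 * s + 8 * r))"
    using mult_left_mono[OF u, of "M1\<^sup>2"] mult_left_mono[OF d, of i] nonneg by auto
  also have "\<dots> \<le> (8 * M1\<^sup>2 + 24 * i) * (e + s) + (2 * M2\<^sup>2 + 8 * M1\<^sup>2 * r + 16 * i * r)"
    using nonneg by (simp add: algebra_simps)
  also have "\<dots> \<le> growth * (e + s) + growth"
  proof (intro add_mono mult_right_mono)
    show "8 * M1\<^sup>2 + 24 * i \<le> growth" "2 * M2\<^sup>2 + 8 * M1\<^sup>2 * r + 16 * i * r \<le> growth"
      by (simp_all add: growth_def defs)
  qed (use nonneg in simp)
  finally show ?thesis by (simp add: defs algebra_simps)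
qed

text \<open>The second summand is the noise constant. The first secures
  \<open>c\<^sup>2 \<le> C\<close> for \<open>c = 2 * theta / lam\<close>, as
  \<open>recursion_powr_decay\<close> demands.\<close>

definition C :: real where "C = (2 * theta / lam)\<^sup>2 + theta\<^sup>2 * growth"

lemma growth_nonneg: "0 \<le> growth"
  by (simp add: growth_def)

text \<open>The proximal term makes the mean direction strongly monotone with modulus
  \<open>1 / lam\<close> relative to \<open>J c\<close>, the solution of the subproblem. So
  \<open>stochastic_step_bound\<close> applies with step size \<open>theta / t\<close>, and
  \<open>direction_growth\<close> absorbs the second moment into \<open>C\<close>.\<close>

lemma step_error:
  fixes j :: nat
  assumes "u \<in> D"
  defines "t \<equiv> real (Suc j)"
  shows "integrable P (\<lambda>y. (norm (step j c u y - J c))\<^sup>2) \<and>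
    (\<integral>y. (norm (step j c u y - J c))\<^sup>2 \<partial>P)
      \<le> (1 - (2 * theta / lam) / t + C / t\<^sup>2) * (norm (u - J c))\<^sup>2 + C / t\<^sup>2 * (1 + (norm c)\<^sup>2)"
proof -
  interpret P: prob_space P by (rule P)
  have v: "integrable P (v u)" "integral\<^sup>L P (v u) \<in> T u" "integrable P (\<lambda>y. (norm (v u y))\<^sup>2)"
      "(\<integral>y. (norm (v u y))\<^sup>2 \<partial>P) \<le> M1\<^sup>2 * (norm u)\<^sup>2 + M2\<^sup>2"
    using first_order_info \<open>u \<in> D\<close> by (auto simp: stochastic_oracle_def)
  have t: "t > 0" by (simp add: t_def)
  define d e where "d = (1 / lam) *\<^sub>R (u - c)" and "e = (norm (u - J c))\<^sup>2"
  have e: "0 \<le> e" by (simp add: e_def)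
  have mono: "(1 / lam) * (norm (u - J c))\<^sup>2 \<le> (integral\<^sup>L P (v u) + d) \<bullet> (u - J c)"
  proof -
    have "0 \<le> (lam *\<^sub>R integral\<^sup>L P (v u) - (c - J c)) \<bullet> (u - J c)"
      by (rule resolvent_monotone[OF T lam v(2)])
    also have "lam *\<^sub>R integral\<^sup>L P (v u) - (c - J c) = lam *\<^sub>R (integral\<^sup>L P (v u) + d) - (u - J c)"
      using lam by (simp add: d_def scaleR_add_right)
    finally have "(norm (u - J c))\<^sup>2 \<le> lam * ((integral\<^sup>L P (v u) + d) \<bullet> (u - J c))"
      by (simp add: inner_diff_left power2_norm_eq_inner)
    then show ?thesis using lam by (simp add: field_simps)
  qed
  have eq: "step j c u y - J c = (u - J c) - (theta / t) *\<^sub>R (v u y + d)" for y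
    by (simp add: step_def t_def d_def)
  have "integrable P (\<lambda>y. (norm (step j c u y - J c))\<^sup>2) \<and>
    (\<integral>y. (norm (step j c u y - J c))\<^sup>2 \<partial>P) \<le> (1 - 2 * (theta / t) * (1 / lam)) * e
      + (theta / t)\<^sup>2 * (2 * (M1\<^sup>2 * (norm u)\<^sup>2 + M2\<^sup>2) + 2 * (norm d)\<^sup>2)"
    unfolding eq e_def using theta t
    by (intro P.stochastic_step_bound v mono) auto
  moreover have "(1 - 2 * (theta / t) * (1 / lam)) * e
      + (theta / t)\<^sup>2 * (2 * (M1\<^sup>2 * (norm u)\<^sup>2 + M2\<^sup>2) + 2 * (norm d)\<^sup>2)
    \<le> (1 - 2 * (theta / t) * (1 / lam)) * e + (theta / t)\<^sup>2 * (growth * (e + (1 + (norm c)\<^sup>2)))"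
    using direction_growth[of u c] by (intro add_left_mono mult_left_mono) (auto simp: d_def e_def)
  moreover have "\<dots> = (1 - (2 * theta / lam) / t) * e + (theta\<^sup>2 * growth) / t\<^sup>2 * (e + (1 + (norm c)\<^sup>2))"
    by (simp add: power_divide ac_simps)
  moreover have "\<dots> \<le> (1 - (2 * theta / lam) / t) * e + C / t\<^sup>2 * (e + (1 + (norm c)\<^sup>2))"
    using e by (intro add_left_mono mult_right_mono divide_right_mono) (auto simp: C_def)
  moreover have "\<dots> = (1 - (2 * theta / lam) / t + C / t\<^sup>2) * e + C / t\<^sup>2 * (1 + (norm c)\<^sup>2)"
    by (simp only: distrib_left distrib_right add.assoc)
  ultimately show ?thesis unfolding e_def by linarith
qed

text \<open>The centre and the current inner point depend only on samples drawn before
  \<open>\<xi> k j\<close>. Freezing them reduces the claim to \<open>step_error\<close> at fixed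
  arguments.\<close>

lemma inner_error_step:
  assumes j: "j < N k" and "integrable M (\<lambda>\<omega>. (norm (x k \<omega>))\<^sup>2)"
    and "integrable M (\<lambda>\<omega>. (norm (z k j \<omega> - J (x k \<omega>)))\<^sup>2)"
  defines "t \<equiv> real (Suc j)"
  shows "integrable M (\<lambda>\<omega>. (norm (z k (Suc j) \<omega> - J (x k \<omega>)))\<^sup>2) \<and>
    expectation (\<lambda>\<omega>. (norm (z k (Suc j) \<omega> - J (x k \<omega>)))\<^sup>2)
      \<le> (1 - (2 * theta / lam) / t + C / t\<^sup>2) * expectation (\<lambda>\<omega>. (norm (z k j \<omega> - J (x k \<omega>)))\<^sup>2)
        + C / t\<^sup>2 * (1 + expectation (\<lambda>\<omega>. (norm (x k \<omega>))\<^sup>2))"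
proof -
  \<comment> \<open>The past: all samples of earlier outer iterations and those of the current inner
    loop before \<open>j\<close>.\<close>
  define A where "A = {(k', j'). j' < N k' \<and> (k' < k \<or> k' = k \<and> j' < j)}"
  define G where "G \<sigma> =
    (let c = vr_spp v lam theta N x0 (\<lambda>k j. \<sigma> (k, j)) k
     in (c, inner_iterate v lam theta c (\<lambda>j. \<sigma> (k, j)) j))" for \<sigma> :: "nat \<times> nat \<Rightarrow> 'w"
  define h where "h w y = (norm (step j (fst w) (snd w) y - J (fst w)))\<^sup>2" for w y
  define g where "g w = (1 - (2 * theta / lam) / t + C / t\<^sup>2) * (norm (snd w - J (fst w)))\<^sup>2
      + C / t\<^sup>2 * (1 + (norm (fst w))\<^sup>2)" for w :: "'b \<times> 'b"
  have coord: "(\<lambda>\<sigma>. \<sigma> (k', j')) \<in> measurable (PiM A (\<lambda>_. P)) P" if "(k', j') \<in> A" for k' j'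
    using measurable_component_singleton[OF that, of "\<lambda>_. P"] by simp
  have x_meas: "(\<lambda>\<sigma>. vr_spp v lam theta N x0 (\<lambda>k j. \<sigma> (k, j)) k) \<in> borel_measurable (PiM A (\<lambda>_. P))"
    by (rule measurable_vr_spp[OF v_measurable]) (auto intro!: coord simp: A_def)
  have G_meas: "G \<in> measurable (PiM A (\<lambda>_. P)) (borel \<Otimes>\<^sub>M borel)"
    unfolding G_def Let_def using j
    by (intro measurable_Pair x_meas measurable_inner_iterate[OF v_measurable])
      (auto intro!: coord simp: A_def)
  have W: "(x k \<omega>, z k j \<omega>) = G (restrict (\<lambda>i. (case i of (k, j) \<Rightarrow> \<xi> k j) \<omega>) A)" for \<omega>
  proof -
    have "vr_spp v lam theta N x0 (\<lambda>k j. \<xi> k j \<omega>) k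
        = vr_spp v lam theta N x0 (\<lambda>k j. restrict (\<lambda>i. (case i of (k, j) \<Rightarrow> \<xi> k j) \<omega>) A (k, j)) k"
      by (rule vr_spp_cong) (simp add: A_def)
    moreover have "inner_iterate v lam theta c (\<lambda>j. \<xi> k j \<omega>) j = inner_iterate v lam theta c
        (\<lambda>j. restrict (\<lambda>i. (case i of (k, j) \<Rightarrow> \<xi> k j) \<omega>) A (k, j)) j" for c
      using j by (intro inner_iterate_cong) (simp add: A_def)
    ultimately show ?thesis by (simp add: G_def x_def z_def Let_def)
  qed
  have "(\<lambda>p. (snd (fst p), snd p)) \<in> measurable ((borel \<Otimes>\<^sub>M borel) \<Otimes>\<^sub>M P) (borel \<Otimes>\<^sub>M P)"
    by measurable
  from measurable_compose[OF this v_measurable]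
  have v': "(\<lambda>p. v (snd (fst p)) (snd p)) \<in> borel_measurable ((borel \<Otimes>\<^sub>M borel) \<Otimes>\<^sub>M P)"
    by simp
  have h_meas: "(\<lambda>(w, y). h w y) \<in> borel_measurable ((borel \<Otimes>\<^sub>M borel) \<Otimes>\<^sub>M P)"
    unfolding h_def step_def case_prod_beta using v' by measurable
  have "AE \<omega> in M. z k j \<omega> \<in> D"
    using queries by eventually_elim (use j in \<open>simp add: z_def x_def\<close>)
  then have bound: "AE \<omega> in M. integrable P (h (x k \<omega>, z k j \<omega>)) \<and>
      integral\<^sup>L P (h (x k \<omega>, z k j \<omega>)) \<le> g (x k \<omega>, z k j \<omega>)"
    unfolding h_def g_def t_def by eventually_elim (use step_error in simp)
  have "integrable M (\<lambda>\<omega>. g (x k \<omega>, z k j \<omega>))" unfolding g_def using assms by simp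
  then have "integrable M (\<lambda>\<omega>. h (x k \<omega>, z k j \<omega>) ((case (k, j) of (k, j) \<Rightarrow> \<xi> k j) \<omega>)) \<and>
      expectation (\<lambda>\<omega>. h (x k \<omega>, z k j \<omega>) ((case (k, j) of (k, j) \<Rightarrow> \<xi> k j) \<omega>))
        \<le> expectation (\<lambda>\<omega>. g (x k \<omega>, z k j \<omega>))"
    using j law
    by (intro expectation_freeze_le[OF indep _ _ _ _ h_meas _ G_meas W bound])
      (auto simp: A_def h_def)
  moreover have "h (x k \<omega>, z k j \<omega>) ((case (k, j) of (k, j) \<Rightarrow> \<xi> k j) \<omega>)
      = (norm (z k (Suc j) \<omega> - J (x k \<omega>)))\<^sup>2" for \<omega>
    by (simp add: h_def z_Suc)
  moreover have "expectation (\<lambda>\<omega>. g (x k \<omega>, z k j \<omega>))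
      = (1 - (2 * theta / lam) / t + C / t\<^sup>2) * expectation (\<lambda>\<omega>. (norm (z k j \<omega> - J (x k \<omega>)))\<^sup>2)
        + C / t\<^sup>2 * (1 + expectation (\<lambda>\<omega>. (norm (x k \<omega>))\<^sup>2))"
    unfolding g_def using assms(2,3) by (simp add: prob_space)
  ultimately show ?thesis by simp
qed

text \<open>This is \<open>recursion_powr_decay\<close> with \<open>p = 2 * q\<close> and
  \<open>c = 2 * theta / lam\<close>; the conditions on \<open>q\<close> say \<open>p < 1\<close>
  and \<open>p \<le> c\<close>. The constant is uniform in \<open>k\<close>. Square integrability of
  \<open>x k\<close> stays a premise because it is proved afterwards by induction with this very
  estimate.\<close>

lemma inner_error:
  assumes q: "0 \<le> q" "q < 1 / 2" "q \<le> theta / lam"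
  shows "\<exists>K\<ge>0. \<forall>k. integrable M (\<lambda>\<omega>. (norm (x k \<omega>))\<^sup>2) \<longrightarrow>
      integrable M (\<lambda>\<omega>. (norm (x (Suc k) \<omega> - J (x k \<omega>)))\<^sup>2) \<and>
      expectation (\<lambda>\<omega>. (norm (x (Suc k) \<omega> - J (x k \<omega>)))\<^sup>2)
        \<le> K * (1 + expectation (\<lambda>\<omega>. (norm (x k \<omega>))\<^sup>2)) * real (Suc (N k)) powr (- (2 * q))"
proof -
  have "0 \<le> 2 * q" "2 * q < 1" "2 * q \<le> 2 * theta / lam" "(2 * theta / lam)\<^sup>2 \<le> C"
    using q growth_nonneg by (auto simp: C_def)
  then obtain K where K: "0 \<le> K" and decay: "\<And>e B n. \<lbrakk>\<And>j. 0 \<le> e j; 0 \<le> B;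
      \<And>j. j < n \<Longrightarrow> e (Suc j) \<le> (1 - 2 * theta / lam / real (Suc j) + C / (real (Suc j))\<^sup>2) * e j
        + C / (real (Suc j))\<^sup>2 * B\<rbrakk>
      \<Longrightarrow> e n \<le> K * (e 0 + B) * real (Suc n) powr (- (2 * q))"
    by (rule recursion_powr_decay) blast
  define r where "r = (norm (J 0))\<^sup>2"
  have "integrable M (\<lambda>\<omega>. (norm (x (Suc k) \<omega> - J (x k \<omega>)))\<^sup>2) \<and>
      expectation (\<lambda>\<omega>. (norm (x (Suc k) \<omega> - J (x k \<omega>)))\<^sup>2)
        \<le> (K * (7 + 4 * r)) * (1 + expectation (\<lambda>\<omega>. (norm (x k \<omega>))\<^sup>2)) * real (Suc (N k)) powr (- (2 * q))"
    if int: "integrable M (\<lambda>\<omega>. (norm (x k \<omega>))\<^sup>2)" for k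
  proof -
    define e where "e j = expectation (\<lambda>\<omega>. (norm (z k j \<omega> - J (x k \<omega>)))\<^sup>2)" for j
    define s where "s = expectation (\<lambda>\<omega>. (norm (x k \<omega>))\<^sup>2)"
    have "0 \<le> s" "0 \<le> r" by (simp_all add: s_def r_def)
    have initial_le: "(norm (x k \<omega> - J (x k \<omega>)))\<^sup>2 \<le> 6 * (norm (x k \<omega>))\<^sup>2 + 4 * r" for \<omega>
      using norm_add_power2_le[of 1 "x k \<omega>" "- J (x k \<omega>)"] norm_J_power2_le[of "x k \<omega>"]
      by (simp add: r_def)
    have initial: "integrable M (\<lambda>\<omega>. (norm (x k \<omega> - J (x k \<omega>)))\<^sup>2)"
      by (rule Bochner_Integration.integrable_bound[of M "\<lambda>\<omega>. 6 * (norm (x k \<omega>))\<^sup>2 + 4 * r"])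
        (use int initial_le \<open>0 \<le> r\<close> in auto)
    have z_int: "integrable M (\<lambda>\<omega>. (norm (z k j \<omega> - J (x k \<omega>)))\<^sup>2)" if "j \<le> N k" for j
      using that
    proof (induction j)
      case 0
      then show ?case using initial by (simp add: z_0)
    next
      case (Suc j)
      then show ?case using inner_error_step[of j k] int by simp
    qed
    have "e (N k) \<le> K * (e 0 + (1 + s)) * real (Suc (N k)) powr (- (2 * q))"
    proof (rule decay)
      show "e (Suc j) \<le> (1 - 2 * theta / lam / real (Suc j) + C / (real (Suc j))\<^sup>2) * e j
        + C / (real (Suc j))\<^sup>2 * (1 + s)" if "j < N k" for j
        using inner_error_step[OF that int z_int] that unfolding e_def s_def by simp
    qed (use \<open>0 \<le> s\<close> in \<open>auto simp: e_def\<close>)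
    \<comment> \<open>The inner loop starts at the centre, so
      \<open>e 0 \<le> 6 * s + 4 * r\<close>. Adding the nonnegative terms 6 and
      \<open>4 * r * s\<close> to \<open>7 * s + 4 * r + 1\<close> completes the product
      \<open>(7 + 4 * r) * (1 + s)\<close>.\<close>
    also have "\<dots> \<le> (K * (7 + 4 * r)) * (1 + s) * real (Suc (N k)) powr (- (2 * q))"
    proof (intro mult_right_mono)
      have "e 0 \<le> expectation (\<lambda>\<omega>. 6 * (norm (x k \<omega>))\<^sup>2 + 4 * r)"
        unfolding e_def z_0 using int initial initial_le by (intro integral_mono) auto
      also have "\<dots> = 6 * s + 4 * r" using int by (simp add: s_def prob_space)
      finally have "e 0 + (1 + s) \<le> 7 + 7 * s + 4 * r + 4 * (r * s)"
        using \<open>0 \<le> s\<close> mult_nonneg_nonneg[OF \<open>0 \<le> r\<close> \<open>0 \<le> s\<close>] by linarith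
      also have "\<dots> = (7 + 4 * r) * (1 + s)" by (simp add: algebra_simps)
      finally have "e 0 + (1 + s) \<le> (7 + 4 * r) * (1 + s)" .
      then show "K * (e 0 + (1 + s)) \<le> (K * (7 + 4 * r)) * (1 + s)"
        using mult_left_mono[OF _ K] by (simp add: mult.assoc)
    qed simp
    finally show ?thesis using z_int[of "N k"] by (simp add: e_def s_def x_Suc)
  qed
  note bound = this
  show ?thesis
  proof (rule exI, rule conjI)
    show "0 \<le> K * (7 + 4 * r)" using K by (simp add: r_def)
  qed (rule allI, rule impI, rule bound)
qed

section \<open>Uniform second moments and almost sure convergence\<close>

lemma square_integrable_add:
  fixes f g :: "'a \<Rightarrow> 'b"
  assumes [measurable]: "f \<in> borel_measurable M" "g \<in> borel_measurable M"
    and "integrable M (\<lambda>\<omega>. (norm (f \<omega>))\<^sup>2)" "integrable M (\<lambda>\<omega>. (norm (g \<omega>))\<^sup>2)"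
  shows "integrable M (\<lambda>\<omega>. (norm (f \<omega> + g \<omega>))\<^sup>2)"
proof (rule Bochner_Integration.integrable_bound)
  show "integrable M (\<lambda>\<omega>. 2 * (norm (f \<omega>))\<^sup>2 + 2 * (norm (g \<omega>))\<^sup>2)" using assms by simp
  show "AE \<omega> in M. norm ((norm (f \<omega> + g \<omega>))\<^sup>2) \<le> norm (2 * (norm (f \<omega>))\<^sup>2 + 2 * (norm (g \<omega>))\<^sup>2)"
  proof (rule AE_I2)
    show "norm ((norm (f \<omega> + g \<omega>))\<^sup>2) \<le> norm (2 * (norm (f \<omega>))\<^sup>2 + 2 * (norm (g \<omega>))\<^sup>2)" for \<omega>
      using norm_add_power2_le[of 1 "f \<omega>" "g \<omega>"] by simp
  qed
qed simp

lemma square_integrable_J: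
  assumes "integrable M (\<lambda>\<omega>. (norm (x k \<omega>))\<^sup>2)"
  shows "integrable M (\<lambda>\<omega>. (norm (J (x k \<omega>)))\<^sup>2)"
proof (rule Bochner_Integration.integrable_bound)
  show "integrable M (\<lambda>\<omega>. 2 * (norm (x k \<omega>))\<^sup>2 + 2 * (norm (J 0))\<^sup>2)" using assms by simp
  show "AE \<omega> in M. norm ((norm (J (x k \<omega>)))\<^sup>2) \<le> norm (2 * (norm (x k \<omega>))\<^sup>2 + 2 * (norm (J 0))\<^sup>2)"
    using norm_J_power2_le by simp
qed simp

lemma square_integrable_x:
  assumes "0 \<le> q" "q < 1 / 2" "q \<le> theta / lam"
  shows "integrable M (\<lambda>\<omega>. (norm (x k \<omega>))\<^sup>2)"
proof (induction k)
  case 0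
  then show ?case by (simp add: x_0)
next
  case (Suc k)
  have "integrable M (\<lambda>\<omega>. (norm (x (Suc k) \<omega> - J (x k \<omega>)))\<^sup>2)"
    using inner_error[OF assms] Suc.IH by (elim exE conjE allE[of _ k]) simp
  then have "integrable M (\<lambda>\<omega>. (norm ((x (Suc k) \<omega> - J (x k \<omega>)) + J (x k \<omega>)))\<^sup>2)"
    using square_integrable_J[OF Suc.IH] by (intro square_integrable_add) auto
  then show ?case by simp
qed

text \<open>The bound of \<open>inner_error\<close> still contains the second moment of
  \<open>x k\<close>. A Gronwall estimate along the outer loop bounds these moments uniformly and
  leaves a constant times the squared weight.\<close>

lemma error_L2_bound:
  assumes q: "0 \<le> q" "q < 1 / 2" "q \<le> theta / lam"
    and sum: "summable (\<lambda>k. real (Suc (N k)) powr (- q))"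
  shows "\<exists>K\<ge>0. \<forall>k. integrable M (\<lambda>\<omega>. (norm (x (Suc k) \<omega> - J (x k \<omega>)))\<^sup>2) \<and>
    expectation (\<lambda>\<omega>. (norm (x (Suc k) \<omega> - J (x k \<omega>)))\<^sup>2) \<le> K * (real (Suc (N k)) powr (- q))\<^sup>2"
proof -
  define \<delta> where "\<delta> k = real (Suc (N k)) powr (- q)" for k
  have \<delta>: "0 < \<delta> k" "\<delta> k \<le> 1" "real (Suc (N k)) powr (- (2 * q)) = (\<delta> k)\<^sup>2" for k
  proof -
    show "0 < \<delta> k" by (simp add: \<delta>_def)
    have "\<delta> k \<le> real (Suc (N k)) powr 0"
      unfolding \<delta>_def using q by (intro powr_mono) auto
    then show "\<delta> k \<le> 1" by simp
    show "real (Suc (N k)) powr (- (2 * q)) = (\<delta> k)\<^sup>2"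
      by (simp add: \<delta>_def power2_eq_square flip: powr_add)
  qed
  have x_int: "integrable M (\<lambda>\<omega>. (norm (x k \<omega>))\<^sup>2)" for k
    by (rule square_integrable_x[OF q])
  obtain K where K: "0 \<le> K"
    and err: "\<forall>k. integrable M (\<lambda>\<omega>. (norm (x k \<omega>))\<^sup>2) \<longrightarrow>
      integrable M (\<lambda>\<omega>. (norm (x (Suc k) \<omega> - J (x k \<omega>)))\<^sup>2) \<and>
      expectation (\<lambda>\<omega>. (norm (x (Suc k) \<omega> - J (x k \<omega>)))\<^sup>2)
        \<le> K * (1 + expectation (\<lambda>\<omega>. (norm (x k \<omega>))\<^sup>2)) * real (Suc (N k)) powr (- (2 * q))"
    using inner_error[OF q] by (elim exE conjE)
  note err = mp[OF spec[OF err] x_int, unfolded \<delta>(3)]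
  obtain z0 where z0: "z0 \<in> zeros T" using zeros by blast
  \<comment> \<open>Distances are measured from a zero of \<open>T\<close> because \<open>J\<close>
    does not increase them; the recursion for \<open>V\<close> thus has leading coefficient 1 up to
    a summable perturbation.\<close>
  define V where "V k = expectation (\<lambda>\<omega>. (norm (x k \<omega> - z0))\<^sup>2)" for k
  define r where "r = 1 + 2 * (norm z0)\<^sup>2"
  have V_int: "integrable M (\<lambda>\<omega>. (norm (x k \<omega> - z0))\<^sup>2)" for k
    using square_integrable_add[of "x k" "\<lambda>_. - z0"] x_int by simp
  have V: "0 \<le> V k" for k by (simp add: V_def)
  have second_moment: "1 + expectation (\<lambda>\<omega>. (norm (x k \<omega>))\<^sup>2) \<le> 2 * V k + r" for k
  proof -
    have "(norm (x k \<omega>))\<^sup>2 \<le> 2 * (norm (x k \<omega> - z0))\<^sup>2 + 2 * (norm z0)\<^sup>2" for \<omega>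
      using norm_add_power2_le[of 1 "x k \<omega> - z0" z0] by simp
    then have "expectation (\<lambda>\<omega>. (norm (x k \<omega>))\<^sup>2)
        \<le> expectation (\<lambda>\<omega>. 2 * (norm (x k \<omega> - z0))\<^sup>2 + 2 * (norm z0)\<^sup>2)"
      using x_int V_int by (intro integral_mono) auto
    also have "\<dots> = 2 * V k + 2 * (norm z0)\<^sup>2" using V_int by (simp add: V_def prob_space)
    finally show ?thesis by (simp add: r_def)
  qed
  have err_le: "expectation (\<lambda>\<omega>. (norm (x (Suc k) \<omega> - J (x k \<omega>)))\<^sup>2) \<le> K * (2 * V k + r) * (\<delta> k)\<^sup>2"
    for k
  proof -
    have "K * (1 + expectation (\<lambda>\<omega>. (norm (x k \<omega>))\<^sup>2)) * (\<delta> k)\<^sup>2 \<le> K * (2 * V k + r) * (\<delta> k)\<^sup>2"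
      using K by (intro mult_right_mono mult_left_mono second_moment) auto
    then show ?thesis using err[of k] by linarith
  qed
  have V_step: "V (Suc k) \<le> (1 + (1 + 4 * K) * \<delta> k) * V k + 2 * K * r * \<delta> k" for k
  proof -
    \<comment> \<open>The weight \<open>\<delta> k\<close> is summable and of the order of the \<open>L\<^sup>2\<close> error, so both terms are perturbations of order \<open>\<delta> k\<close>.\<close>
    have "(norm (x (Suc k) \<omega> - z0))\<^sup>2 \<le> (1 + \<delta> k) * (norm (x k \<omega> - z0))\<^sup>2
        + (1 + 1 / \<delta> k) * (norm (x (Suc k) \<omega> - J (x k \<omega>)))\<^sup>2" for \<omega>
    proof -
      have "(norm (J (x k \<omega>) - z0))\<^sup>2 \<le> (norm (x k \<omega> - z0))\<^sup>2"
        using resolvent_decrease[OF T lam z0, of "x k \<omega>"]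
          zero_le_power2[of "norm (x k \<omega> - J (x k \<omega>))"] by linarith
      then have "(1 + \<delta> k) * (norm (J (x k \<omega>) - z0))\<^sup>2 \<le> (1 + \<delta> k) * (norm (x k \<omega> - z0))\<^sup>2"
        using \<delta>(1)[of k] by (intro mult_left_mono) auto
      then show ?thesis
        using norm_add_power2_le[OF \<delta>(1)[of k], of "J (x k \<omega>) - z0" "x (Suc k) \<omega> - J (x k \<omega>)"]
        by simp
    qed
    then have "V (Suc k) \<le> expectation (\<lambda>\<omega>. (1 + \<delta> k) * (norm (x k \<omega> - z0))\<^sup>2
        + (1 + 1 / \<delta> k) * (norm (x (Suc k) \<omega> - J (x k \<omega>)))\<^sup>2)"
      unfolding V_def using V_int err by (intro integral_mono) auto
    also have "\<dots> = (1 + \<delta> k) * V k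
        + (1 + 1 / \<delta> k) * expectation (\<lambda>\<omega>. (norm (x (Suc k) \<omega> - J (x k \<omega>)))\<^sup>2)"
      using V_int err by (simp add: V_def)
    also have "\<dots> \<le> (1 + \<delta> k) * V k + (1 + 1 / \<delta> k) * (K * (2 * V k + r) * (\<delta> k)\<^sup>2)"
      using \<delta>(1)[of k] by (intro add_left_mono mult_left_mono err_le) auto
    \<comment> \<open>The large Young factor \<open>1 / \<delta> k\<close> costs one of the two
      powers of \<open>\<delta> k\<close>, and the remaining one is still summable. Then
      \<open>\<delta> k \<le> 1\<close> gives the factor 2.\<close>
    also have "(1 + 1 / \<delta> k) * (K * (2 * V k + r) * (\<delta> k)\<^sup>2) = K * (2 * V k + r) * ((1 + \<delta> k) * \<delta> k)"
      using \<delta>(1)[of k] by (simp add: field_simps power2_eq_square)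
    also have "\<dots> \<le> K * (2 * V k + r) * (2 * \<delta> k)"
      using \<delta>[of k] K V[of k] by (intro mult_left_mono mult_right_mono) (auto simp: r_def)
    finally show ?thesis by (simp add: algebra_simps)
  qed
  define V_bound where
    "V_bound = exp (\<Sum>k. (1 + 4 * K) * \<delta> k) * (V 0 + (\<Sum>k. 2 * K * r * \<delta> k))"
  have "V k \<le> V_bound" for k
    unfolding V_bound_def
    using K V V_step sum \<delta>(1)
    by (intro discrete_Gronwall summable_mult) (auto simp: \<delta>_def[abs_def] r_def less_imp_le)
  then have "K * (2 * V k + r) * (\<delta> k)\<^sup>2 \<le> K * (2 * V_bound + r) * (\<delta> k)\<^sup>2" for k
    using K by (intro mult_right_mono mult_left_mono) auto
  then have "expectation (\<lambda>\<omega>. (norm (x (Suc k) \<omega> - J (x k \<omega>)))\<^sup>2)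
      \<le> K * (2 * V_bound + r) * (real (Suc (N k)) powr (- q))\<^sup>2" for k
    unfolding \<delta>_def[symmetric] by (rule order_trans[OF err_le])
  moreover have "0 \<le> K * (2 * V_bound + r)"
    using K order_trans[OF V \<open>V 0 \<le> V_bound\<close>] by (simp add: r_def)
  ultimately show ?thesis by (intro exI conjI allI conjunct1[OF err])
qed

text \<open>The expected errors are bounded by multiples of the summable weights. Exchanging sum and
  integral makes the errors summable on almost every path, where
  \<open>inexact_proximal_point_converges\<close> applies.\<close>

theorem converges:
  assumes q: "0 \<le> q" "q < 1 / 2" "q \<le> theta / lam"
    and sum: "summable (\<lambda>k. real (Suc (N k)) powr (- q))"
  shows "AE \<omega> in M. \<exists>xstar\<in>zeros T. (\<lambda>k. x k \<omega>) \<longlonglongrightarrow> xstar"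
proof -
  define \<delta> where "\<delta> k = real (Suc (N k)) powr (- q)" for k
  define e where "e k \<omega> = norm (x (Suc k) \<omega> - J (x k \<omega>))" for k \<omega>
  obtain K where "0 \<le> K" and err: "\<forall>k. integrable M (\<lambda>\<omega>. (e k \<omega>)\<^sup>2) \<and>
      expectation (\<lambda>\<omega>. (e k \<omega>)\<^sup>2) \<le> K * (\<delta> k)\<^sup>2"
    using error_L2_bound[OF q sum] unfolding e_def \<delta>_def by (elim exE conjE)
  note K = \<open>0 \<le> K\<close> conjunct1[OF spec[OF err]] conjunct2[OF spec[OF err]]
  have \<delta>: "0 < \<delta> k" for k by (simp add: \<delta>_def)
  have e_meas [measurable]: "e k \<in> borel_measurable M" for k unfolding e_def by measurable
  have "(\<integral>\<^sup>+\<omega>. ennreal (e k \<omega>) \<partial>M) \<le> ennreal ((1 + K) * \<delta> k)" for k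
  proof -
    \<comment> \<open>A pointwise Young inequality that turns the \<open>L\<^sup>2\<close> bound
      into a bound of order \<open>\<delta> k\<close> on the expectation.\<close>
    have "e k \<omega> \<le> \<delta> k + (e k \<omega>)\<^sup>2 / \<delta> k" for \<omega>
    proof -
      have "0 \<le> (e k \<omega> - \<delta> k)\<^sup>2 + e k \<omega> * \<delta> k" using \<delta>[of k] by (simp add: e_def)
      also have "\<dots> = (\<delta> k + (e k \<omega>)\<^sup>2 / \<delta> k - e k \<omega>) * \<delta> k"
        using \<delta>[of k] by (simp add: field_simps power2_eq_square)
      finally show ?thesis using \<delta>[of k] by (simp add: zero_le_mult_iff)
    qed
    then have "(\<integral>\<^sup>+\<omega>. ennreal (e k \<omega>) \<partial>M) \<le> (\<integral>\<^sup>+\<omega>. ennreal (\<delta> k + (e k \<omega>)\<^sup>2 / \<delta> k) \<partial>M)"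
      by (intro nn_integral_mono ennreal_leI)
    also have "\<dots> = ennreal (expectation (\<lambda>\<omega>. \<delta> k + (e k \<omega>)\<^sup>2 / \<delta> k))"
      using \<delta>[of k] K(2) by (intro nn_integral_eq_integral) auto
    also have "expectation (\<lambda>\<omega>. \<delta> k + (e k \<omega>)\<^sup>2 / \<delta> k) = \<delta> k + expectation (\<lambda>\<omega>. (e k \<omega>)\<^sup>2) / \<delta> k"
      using K(2) by (simp add: prob_space)
    also have "\<dots> \<le> \<delta> k + K * (\<delta> k)\<^sup>2 / \<delta> k"
      using \<delta>[of k] K(3)[of k] by (intro add_left_mono divide_right_mono) auto
    also have "\<dots> = (1 + K) * \<delta> k" using \<delta>[of k] by (simp add: field_simps power2_eq_square)
    finally show ?thesis by (simp add: ennreal_leI)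
  qed
  then have "(\<Sum>k. \<integral>\<^sup>+\<omega>. ennreal (e k \<omega>) \<partial>M) \<le> (\<Sum>k. ennreal ((1 + K) * \<delta> k))"
    by (intro suminf_le) auto
  also have "\<dots> < \<infinity>"
    using K(1) \<delta> sum
    by (simp add: ennreal_suminf_neq_top summable_mult \<delta>_def[abs_def] less_imp_le top.not_eq_extremum[symmetric])
  finally have "(\<integral>\<^sup>+\<omega>. (\<Sum>k. ennreal (e k \<omega>)) \<partial>M) \<noteq> \<infinity>"
    by (subst nn_integral_suminf) auto
  then have "AE \<omega> in M. (\<Sum>k. ennreal (e k \<omega>)) \<noteq> \<infinity>"
    by (intro nn_integral_PInf_AE) auto
  then show ?thesis
  proof (rule AE_mp, intro AE_I2 impI)
    fix \<omega> assume "(\<Sum>k. ennreal (e k \<omega>)) \<noteq> \<infinity>"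
    moreover have "0 \<le> e k \<omega>" for k by (simp add: e_def)
    ultimately have "summable (\<lambda>k. e k \<omega>)"
      unfolding infinity_ennreal_def by (rule summable_suminf_not_top[rotated])
    then show "\<exists>xstar\<in>zeros T. (\<lambda>k. x k \<omega>) \<longlonglongrightarrow> xstar"
      unfolding e_def by (rule inexact_proximal_point_converges[OF T lam zeros])
  qed
qed

end

theorem proposition6:
  fixes P :: "'w measure" and M :: "'a measure"
    and own :: "'n::finite \<Rightarrow> 'p::finite" and X :: "'p \<Rightarrow> (real ^ 'n) set"
    and own' :: "'m::finite \<Rightarrow> 'p" and Y :: "'p \<Rightarrow> (real ^ 'm) set"
    and F :: "'p \<Rightarrow> real ^ 'm \<Rightarrow> real ^ 'n \<Rightarrow> 'w \<Rightarrow> real ^ 'm"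
    and f :: "'p \<Rightarrow> real ^ 'n \<Rightarrow> real ^ 'm \<Rightarrow> 'w \<Rightarrow> real"
    and y :: "'p \<Rightarrow> real ^ 'n \<Rightarrow> 'w \<Rightarrow> real ^ 'm"
    and T :: "real ^ 'n \<Rightarrow> (real ^ 'n) set"
    and v :: "real ^ 'n \<Rightarrow> 'w \<Rightarrow> real ^ 'n"
    and M1 M2 lam theta a :: real
    and N :: "nat \<Rightarrow> nat"
    and \<xi> :: "nat \<Rightarrow> nat \<Rightarrow> 'a \<Rightarrow> 'w"
    and x0 :: "real ^ 'n"
  assumes game: "hierarchical_game P own X own' Y F f y"
    and equilibrium: "\<exists>x. nash_equilibrium P own X f y x"
    and T_def: "T = game_T P own X f y"
    and zeros: "zeros T \<noteq> {}"
    and maximal: "maximal_monotone_operator T"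
    and first_order_info: "stochastic_oracle P (block_product own X) (game_Phi own X f y) T M1 M2 v"
    and lam: "lam > 0"
    and a: "a > 1"
    and theta: "theta > lam / (2 * a)"
    and N: "\<And>k. N k = nat \<lceil>real (k + 1) powr (2 * a)\<rceil>"
    and M: "prob_space M"
    and indep: "prob_space.indep_vars M (\<lambda>_. P) (\<lambda>(k, j). \<xi> k j) {(k, j). j < N k}"
    and law: "\<And>k j. j < N k \<Longrightarrow> distr M P (\<xi> k j) = P"
    and queries: "AE \<omega> in M. \<forall>k. \<forall>j<N k.
      inner_iterate v lam theta (vr_spp v lam theta N x0 (\<lambda>k j. \<xi> k j \<omega>) k) (\<lambda>j. \<xi> k j \<omega>) j
        \<in> block_product own X"
  shows "AE \<omega> in M. \<exists>xstar\<in>zeros T.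
    (\<lambda>k. vr_spp v lam theta N x0 (\<lambda>k j. \<xi> k j \<omega>) k) \<longlonglongrightarrow> xstar"
proof -
  have "prob_space P" using game by (simp add: hierarchical_game_def)
  moreover have "theta > 0" using theta lam a by (intro le_less_trans[OF _ theta]) auto
  \<comment> \<open>Here \<open>a > 1\<close> gives the comparison with 1/2 and the lower bound on
    \<open>theta\<close> the one with \<open>theta / lam\<close>. The strict inequality leaves room
    for an exponent \<open>q\<close>.\<close>
  moreover have "1 / (2 * a) < min (1 / 2) (theta / lam)"
    using theta lam a by (simp add: field_simps)
  then obtain q where q: "1 / (2 * a) < q" "q < min (1 / 2) (theta / lam)"
    using dense by blast
  ultimately interpret sampled_vr_spp M P T "block_product own X" "game_Phi own X f y" M1 M2 lam theta v N \<xi> x0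
    using assms by (intro sampled_vr_spp.intro sampled_vr_spp_axioms.intro) auto
  have "0 \<le> 1 / (2 * a)" using a by simp
  then have "0 \<le> q" using q(1) by linarith
  have "summable (\<lambda>k. real (Suc (N k)) powr (- q))"
  proof (rule summable_comparison_test')
    have "1 < 2 * a * q" using q(1) a by (simp add: field_simps)
    then show "summable (\<lambda>k. real (Suc k) powr (- (2 * a * q)))"
      by (intro summable_Suc_powr) simp
    fix k :: nat
    \<comment> \<open>Rounding up and taking the successor only enlarge the sample size, so the
      weight is at most \<open>real (Suc k) powr (- (2 * a * q))\<close>, with
      \<open>2 * a * q > 1\<close>.\<close>
    have "real (Suc k) powr (2 * a) \<le> real (Suc (N k))"
      unfolding N by simp linarith
    then have "real (Suc (N k)) powr (- q) \<le> (real (Suc k) powr (2 * a)) powr (- q)"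
      using \<open>0 \<le> q\<close> by (intro powr_mono2') auto
    then show "norm (real (Suc (N k)) powr (- q)) \<le> real (Suc k) powr (- (2 * a * q))"
      by (simp add: powr_powr)
  qed
  then have "AE \<omega> in M. \<exists>xstar\<in>zeros T. (\<lambda>k. x k \<omega>) \<longlonglongrightarrow> xstar"
    using q \<open>0 \<le> q\<close> by (intro converges) auto
  then show ?thesis by (simp add: x_def)
qed

end
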